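(* Let $p\in(0,1)$ be fixed, $\sigma=\sqrt{p(1-p)}$, and let $G_n(p)$ be the Erdős–Rényi random graph on $\{1,\dots,n\}$ (each edge present independently with probability $p$). Then almost every $G_n(p)$ satisfies $$\left(\frac{2\sqrt2}{3}\sigma+o(1)\right)n^{3/2}\le \mathcal{LE}(G_n(p))\le\left(\sqrt2\,\sigma+o(1)\right)n^{3/2},$$ i.e. for every $\varepsilon>0$, $$\Pr\left(\left(\tfrac{2\sqrt2}{3}\sigma-\varepsilon\right)n^{3/2}\le \mathcal{LE}(G_n(p))\le(\sqrt2\,\sigma+\varepsilon)n^{3/2}\right)\to1\quad(n\to\infty).$$
   Context: For a simple graph $G$ on vertices $v_1,\dots,v_n$ with adjacency matrix $\mathbf{A}(G)$, degree diagonal matrix $\mathbf{D}(G)$ and Laplacian $\mathbf{L}(G)=\mathbf{D}(G)-\mathbf{A}(G)$, set $\mathcal{L}(G)=\mathbf{L}(G)-\frac{1}{n}\sum_{i=1}^n d_G(v_i)\,\mathbf{I}_n$. The Laplacian energy is $\mathcal{LE}(G)=\sum_{i=1}^n|\zeta_i|$ where $\zeta_1,\dots,\zeta_n$ are the eigenvalues of $\mathcal{L}(G)$. "Almost every" means with probability tending to $1$ as $n\to\infty$. *)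

theory Defs
  imports
    "HOL-Probability.Product_PMF"
    "HOL-Computational_Algebra.Fundamental_Theorem_Algebra"
    "Jordan_Normal_Form.Char_Poly"
begin

text \<open>
  A simple graph on the vertices \<open>1, \<dots>, n\<close> is represented by its edge set, a subset of
  \<open>vertex_pairs n\<close>. Matrices of \<open>Jordan_Normal_Form\<close> are indexed from 0, so row and column
  \<open>i\<close> belong to the vertex \<open>Suc i\<close>.
\<close>

definition vertex_pairs :: "nat \<Rightarrow> nat set set" where
  "vertex_pairs n = {e. e \<subseteq> {1..n} \<and> card e = 2}"

definition degree_of :: "nat \<Rightarrow> nat set set \<Rightarrow> nat \<Rightarrow> nat" where
  "degree_of n E v = card {w \<in> {1..n}. {v, w} \<in> E}"

definition adjacency_mat :: "nat \<Rightarrow> nat set set \<Rightarrow> real mat" where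
  "adjacency_mat n E = Matrix.mat n n (\<lambda>(i, j). if {Suc i, Suc j} \<in> E then 1 else 0)"

definition degree_mat :: "nat \<Rightarrow> nat set set \<Rightarrow> real mat" where
  "degree_mat n E =
     Matrix.mat n n (\<lambda>(i, j). if i = j then real (degree_of n E (Suc i)) else 0)"

definition laplacian_mat :: "nat \<Rightarrow> nat set set \<Rightarrow> real mat" where
  "laplacian_mat n E = degree_mat n E - adjacency_mat n E"

definition shifted_laplacian_mat :: "nat \<Rightarrow> nat set set \<Rightarrow> real mat" where
  "shifted_laplacian_mat n E =
     laplacian_mat n E - (1 / real n * (\<Sum>v=1..n. real (degree_of n E v))) \<cdot>\<^sub>m 1\<^sub>m n"

text \<open>
  Eigenvalues with algebraic multiplicity. They are taken over the complex numbers so that an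
  \<open>n \<times> n\<close> matrix has exactly \<open>n\<close> of them without appeal to its symmetry.
\<close>

definition eigenvalues_mset :: "real mat \<Rightarrow> complex multiset" where
  "eigenvalues_mset A = proots (char_poly (map_mat complex_of_real A))"

definition laplacian_energy :: "nat \<Rightarrow> nat set set \<Rightarrow> real" where
  "laplacian_energy n E = (\<Sum>\<zeta>\<in>#eigenvalues_mset (shifted_laplacian_mat n E). cmod \<zeta>)"

definition erdos_renyi :: "nat \<Rightarrow> real \<Rightarrow> nat set set pmf" where
  "erdos_renyi n p =
     map_pmf (\<lambda>f. {e \<in> vertex_pairs n. f e})
       (Pi_pmf (vertex_pairs n) False (\<lambda>_. bernoulli_pmf p))"

lemma finite_vertex_pairs: "finite (vertex_pairs n)"
  by (rule finite_subset[of _ "Pow {1..n}"]) (auto simp: vertex_pairs_def)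

lemma set_pmf_erdos_renyi: "E \<in> set_pmf (erdos_renyi n p) \<Longrightarrow> E \<subseteq> vertex_pairs n"
  by (auto simp: erdos_renyi_def)

lemma size_eigenvalues_mset:
  assumes "A \<in> carrier_mat n n"
  shows "size (eigenvalues_mset A) = n"
proof -
  have "map_mat complex_of_real A \<in> carrier_mat n n"
    using assms by simp
  from degree_monic_char_poly[OF this] show ?thesis
    by (simp add: eigenvalues_mset_def size_proots_complex)
qed

lemma shifted_laplacian_mat_carrier: "shifted_laplacian_mat n E \<in> carrier_mat n n"
  by (auto simp: shifted_laplacian_mat_def laplacian_mat_def degree_mat_def adjacency_mat_def)

end

theory Submission
  imports Defs "HOL-Real_Asymp.Real_Asymp"
begin

text \<open>
  The Laplacian energy is the trace norm of the shifted Laplacian \<open>M\<close>. Let \<open>B\<close> be the Laplacian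
  with the centered edge weights \<open>y\<^sub>e = 1\<^sub>e - p\<close>. Then \<open>M - B\<close> is a combination of the all-ones
  matrix and the identity whose trace norm is \<open>o(n\<^sup>3\<^sup>/\<^sup>2)\<close> with high probability, so \<open>M\<close> may be
  replaced by \<open>B\<close>.

  Flipping an edge changes \<open>B\<close> by a rank-one matrix of trace norm 2, so the trace norm of \<open>B\<close> is a
  Lipschitz function of independent bits and has variance \<open>O(n\<^sup>2)\<close>, which is negligible on the
  scale \<open>n\<^sup>3\<close>. It remains to estimate its mean. Summing the inequalities
  \<open>3 x\<^sup>2 / (2 t) - x\<^sup>4 / (2 t\<^sup>3) \<le> \<bar>x\<bar> \<le> x\<^sup>2 / (2 t) + t / 2\<close> over the spectrum reduces
  this to \<open>E tr B\<^sup>2 = 2 n (n - 1) \<sigma>\<^sup>2\<close> and \<open>E tr B\<^sup>4 \<le> 9 \<sigma>\<^sup>4 n\<^sup>3 + O(n\<^sup>2)\<close>; the optimal choices of \<open>t\<close>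
  give the constants \<open>2 \<surd>2 / 3\<close> and \<open>\<surd>2\<close>.
\<close>

section \<open>Trace norm of real symmetric matrices\<close>

lemma index_conj_mat_diag:
  fixes P :: "real mat"
  assumes P: "P \<in> carrier_mat n n" and ij: "i < n" "j < n"
  shows "(P * mat_diag n d * transpose_mat P) $$ (i, j) =
         (\<Sum>k<n. d k * P $$ (i, k) * P $$ (j, k))"
proof -
  have "(P * mat_diag n d * transpose_mat P) $$ (i, j) =
        (\<Sum>k<n. (P * mat_diag n d) $$ (i, k) * transpose_mat P $$ (k, j))"
    using P ij by (subst index_mult_mat) (auto simp: scalar_prod_def atLeast0LessThan mat_diag_def
        simp del: index_mult_mat(1))
  also have "\<dots> = (\<Sum>k<n. d k * P $$ (i, k) * P $$ (j, k))"
    using P ij by (intro sum.cong) (auto simp: mat_diag_mult_right[OF P] mult_ac)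
  finally show ?thesis .
qed

text \<open>For an eigenvector \<open>x\<close>, the form \<open>S\<close> = sum of conj(x_i) a_ij
  x_j equals \<open>z\<close> times the squared norm \<open>N\<close>. Since the matrix is real and
  symmetric, conjugation only swaps the two summation indices, so \<open>S\<close> is real; and
  \<open>N\<close> is nonzero.\<close>

lemma symmetric_eigenvalue_real:
  fixes A :: "real mat"
  assumes A: "A \<in> carrier_mat n n" and sym: "transpose_mat A = A"
    and ev: "eigenvalue (map_mat complex_of_real A) z"
  shows "Im z = 0"
proof -
  let ?A = "map_mat complex_of_real A"
  obtain v where v: "v \<in> carrier_vec n" "v \<noteq> 0\<^sub>v n" "?A *\<^sub>v v = z \<cdot>\<^sub>v v"
    using ev A unfolding eigenvalue_def eigenvector_def by auto
  define x where "x = vec_index v"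
  have symA: "A $$ (i, j) = A $$ (j, i)" if "i < n" "j < n" for i j
  proof -
    have "transpose_mat A $$ (i, j) = A $$ (j, i)" using A that by simp
    then show ?thesis by (simp add: sym)
  qed
  have ev: "(\<Sum>j<n. of_real (A $$ (i, j)) * x j) = z * x i" if "i < n" for i
  proof -
    have "vec_index (?A *\<^sub>v v) i = vec_index (z \<cdot>\<^sub>v v) i" by (simp add: v)
    then show ?thesis using A v(1) that
      by (simp add: scalar_prod_def atLeast0LessThan x_def)
  qed
  define S where "S = (\<Sum>i<n. \<Sum>j<n. cnj (x i) * of_real (A $$ (i, j)) * x j)"
  define N where "N = (\<Sum>i<n. (cmod (x i))\<^sup>2)"
  have S: "S = z * of_real N"
  proof -
    have "S = (\<Sum>i<n. cnj (x i) * (\<Sum>j<n. of_real (A $$ (i, j)) * x j))"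
      unfolding S_def by (simp add: sum_distrib_left mult_ac)
    also have "\<dots> = (\<Sum>i<n. z * of_real ((cmod (x i))\<^sup>2))"
      by (intro sum.cong refl, subst ev) (auto simp: complex_norm_square mult_ac simp del: of_real_power)
    finally show ?thesis by (simp add: N_def sum_distrib_left)
  qed
  have "cnj S = (\<Sum>i<n. \<Sum>j<n. cnj (x j) * of_real (A $$ (j, i)) * x i)"
    unfolding S_def using symA by (auto intro!: sum.cong simp: mult_ac)
  also have "\<dots> = S" unfolding S_def by (rule sum.swap)
  finally have "Im S = 0" by (metis complex_cnj_cancel_iff Reals_cnj_iff complex_is_Real_iff)
  moreover have "N \<noteq> 0"
  proof
    assume "N = 0"
    then have "\<forall>i<n. x i = 0" unfolding N_def by (subst (asm) sum_nonneg_eq_0_iff) auto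
    then have "v = 0\<^sub>v n" using v(1) by (intro eq_vecI) (auto simp: x_def)
    with v(2) show False by simp
  qed
  ultimately show ?thesis using S by simp
qed

text \<open>The characteristic polynomial splits over the complex numbers, so a root exists because
  \<open>n > 0\<close>. By symmetry the root is real, hence a root of the real characteristic
  polynomial, and a real eigenvector can be normalized.\<close>

lemma symmetric_real_eigenvector:
  fixes A :: "real mat"
  assumes A: "A \<in> carrier_mat n n" and sym: "transpose_mat A = A" and n: "n > 0"
  shows "\<exists>r v. v \<in> carrier_vec n \<and> (\<Sum>i<n. (vec_index v i)\<^sup>2) = 1 \<and> A *\<^sub>v v = r \<cdot>\<^sub>v v"
proof -
  let ?A = "map_mat complex_of_real A"
  have cA: "?A \<in> carrier_mat n n" using A by simp
  obtain as where as: "char_poly ?A = (\<Prod>a\<leftarrow>as. [:- a, 1:])" "length as = n"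
    using char_poly_factorized[OF cA] by auto
  then obtain z as' where "as = z # as'" using n by (cases as) auto
  then have root: "poly (char_poly ?A) z = 0" using as(1) by simp
  then have "eigenvalue ?A z" using eigenvalue_root_char_poly[OF cA] by simp
  then have "Im z = 0" by (rule symmetric_eigenvalue_real[OF A sym])
  then have z: "z = of_real (Re z)" by (simp add: complex_eq_iff)
  have "char_poly ?A = map_poly of_real (char_poly A)"
    by (rule of_real_hom.char_poly_hom[OF A])
  then have "poly (char_poly A) (Re z) = 0"
    using root z by (metis of_real_eq_0_iff of_real_hom.poly_map_poly)
  then have "eigenvalue A (Re z)" using eigenvalue_root_char_poly[OF A] by simp
  then obtain v where v: "v \<in> carrier_vec n" "v \<noteq> 0\<^sub>v n" "A *\<^sub>v v = Re z \<cdot>\<^sub>v v"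
    using A unfolding eigenvalue_def eigenvector_def by auto
  define N where "N = (\<Sum>i<n. (vec_index v i)\<^sup>2)"
  have "N \<noteq> 0"
  proof
    assume "N = 0"
    then have "\<forall>i<n. vec_index v i = 0" unfolding N_def by (subst (asm) sum_nonneg_eq_0_iff) auto
    then have "v = 0\<^sub>v n" using v(1) by (intro eq_vecI) auto
    with v(2) show False by simp
  qed
  moreover have "N \<ge> 0" unfolding N_def by (intro sum_nonneg) auto
  ultimately have N: "N > 0" by simp
  define u where "u = (1 / sqrt N) \<cdot>\<^sub>v v"
  have "u \<in> carrier_vec n" using v by (simp add: u_def)
  moreover have "(\<Sum>i<n. (vec_index u i)\<^sup>2) = 1"
  proof -
    have "(\<Sum>i<n. (vec_index u i)\<^sup>2) = (\<Sum>i<n. (vec_index v i)\<^sup>2 / N)"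
      using N v(1) by (intro sum.cong) (auto simp: u_def power_divide)
    then show ?thesis using N by (simp add: N_def flip: sum_divide_distrib)
  qed
  moreover have "A *\<^sub>v u = Re z \<cdot>\<^sub>v u"
    using v A by (simp add: u_def mult_mat_vec smult_smult_assoc mult_ac)
  ultimately show ?thesis by blast
qed

lemma orthogonal_reflection_exists:
  fixes v :: "real vec"
  assumes v: "v \<in> carrier_vec n" and unit: "(\<Sum>i<n. (vec_index v i)\<^sup>2) = 1" and n: "n > 0"
  shows "\<exists>W. W \<in> carrier_mat n n \<and> transpose_mat W = W \<and> W * W = 1\<^sub>m n \<and> col W 0 = v"
proof -
  \<comment> \<open>The Householder reflection along \<open>v - e\<^sub>0\<close>; for \<open>v = e\<^sub>0\<close> the convention \<open>2 / 0 = 0\<close> makes it the identity.\<close>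
  define w where "w i = vec_index v i - of_bool (i = 0)" for i
  define s where "s = (\<Sum>i<n. (w i)\<^sup>2)"
  define c where "c = 2 / s"
  define W where "W = Matrix.mat n n (\<lambda>(i, j). of_bool (i = j) - c * w i * w j)"
  have W: "W \<in> carrier_mat n n" by (simp add: W_def)
  have "transpose_mat W = W" by (rule eq_matI) (auto simp: W_def)
  moreover have "W * W = 1\<^sub>m n"
  proof (rule eq_matI)
    fix i j assume ij: "i < dim_row (1\<^sub>m n :: real mat)" "j < dim_col (1\<^sub>m n :: real mat)"
    have "(W * W) $$ (i, j) =
          (\<Sum>k<n. (of_bool (i = k) - c * w i * w k) * (of_bool (k = j) - c * w k * w j))"
      using ij by (simp add: W_def scalar_prod_def atLeast0LessThan)
    also have "\<dots> = (\<Sum>k<n. of_bool (i = k) * of_bool (k = j) - of_bool (i = k) * (c * w k * w j)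
        - of_bool (k = j) * (c * w i * w k) + c * c * w i * w j * (w k)\<^sup>2)"
      by (intro sum.cong) (auto simp: algebra_simps power2_eq_square)
    also have "\<dots> = of_bool (i = j) - 2 * (c * w i * w j) + c * c * w i * w j * s"
      using ij by (simp add: sum.distrib sum_subtractf s_def sum_distrib_left of_bool_def
          if_distrib[of "\<lambda>x. x * _"] cong: if_cong)
    also have "c * c * w i * w j * s = 2 * (c * w i * w j)" by (simp add: c_def)
    finally show "(W * W) $$ (i, j) = 1\<^sub>m n $$ (i, j)" using ij by simp
  qed (simp_all add: W_def)
  moreover have "col W 0 = v"
  proof (rule eq_vecI)
    fix i assume i: "i < dim_vec v"
    then have i': "i < n" using v by simp
    \<comment> \<open>As \<open>v\<close> is a unit vector, the squared length of v - e_0 is 2 - 2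
      v_0. This relation between \<open>s\<close> and \<open>w 0\<close> is what makes the first
      column of \<open>W\<close> equal to \<open>v\<close>.\<close>
    have "s = (\<Sum>k<n. (vec_index v k)\<^sup>2 - 2 * of_bool (k = 0) * vec_index v k + of_bool (k = 0))"
      unfolding s_def w_def by (intro sum.cong) (auto simp: power2_eq_square algebra_simps)
    also have "\<dots> = 2 - 2 * vec_index v 0"
      using n by (simp add: sum.distrib sum_subtractf unit of_bool_def if_distrib[of "\<lambda>x. x * _"] 
        if_distrib[of "\<lambda>x. _ * x"] cong: if_cong)
    finally have s: "s = - 2 * w 0" by (simp add: w_def)
    have "c * w i * w 0 = - w i"
    proof (cases "s = 0")
      case True
      then have "w i = 0" using i' unfolding s_def by (subst (asm) sum_nonneg_eq_0_iff) auto
      then show ?thesis by simp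
    next
      case False
      then show ?thesis unfolding c_def using s by (simp add: field_simps)
    qed
    then show "vec_index (col W 0) i = vec_index v i"
      using i' n by (simp add: W_def w_def)
  qed (use v in \<open>simp add: W_def\<close>)
  ultimately show ?thesis using W by blast
qed

text \<open>Induction on the dimension by deflation. Conjugation by a reflection \<open>W\<close>
  that maps e_0 to a unit eigenvector clears the first column except for its top entry; by symmetry
  it clears the first row as well, and the induction hypothesis applies to the remaining block
  \<open>A3\<close>. The matrix \<open>W\<close> is both its own transpose and its own
  inverse.\<close>

theorem symmetric_mat_diagonalization:
  fixes A :: "real mat"
  assumes "A \<in> carrier_mat n n" and "transpose_mat A = A"
  shows "\<exists>P d. P \<in> carrier_mat n n \<and> transpose_mat P * P = 1\<^sub>m n \<and>
           A = P * mat_diag n d * transpose_mat P"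
  using assms
proof (induction n arbitrary: A)
  case 0
  then show ?case by (intro exI[of _ A] exI[of _ "\<lambda>_. 0"]) (auto intro!: eq_matI)
next
  case (Suc m)
  let ?n = "Suc m"
  note A = Suc.prems(1) and sym = Suc.prems(2)
  obtain r v where v: "v \<in> carrier_vec ?n" "(\<Sum>i<?n. (vec_index v i)\<^sup>2) = 1" "A *\<^sub>v v = r \<cdot>\<^sub>v v"
    using symmetric_real_eigenvector[OF A sym] by auto
  obtain W where W: "W \<in> carrier_mat ?n ?n" and WT: "transpose_mat W = W"
    and WW: "W * W = 1\<^sub>m ?n" and W0: "col W 0 = v"
    using orthogonal_reflection_exists[OF v(1,2)] by auto
  define A' where "A' = W * A * W"
  have A': "A' \<in> carrier_mat ?n ?n" using A W by (simp add: A'_def)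
  have symA': "transpose_mat A' = A'"
    using A W by (simp add: A'_def transpose_mult[of _ ?n ?n _ ?n] WT sym assoc_mult_mat[of _ ?n ?n _ ?n _ ?n])
  have A'_sym: "A' $$ (i, j) = A' $$ (j, i)" if "i < ?n" "j < ?n" for i j
  proof -
    have "transpose_mat A' $$ (i, j) = A' $$ (j, i)" using A' that by simp
    then show ?thesis by (simp add: symA')
  qed
  \<comment> \<open>In vector form: W A W e_0 = W A v = r W v = r W W e_0 = r e_0.\<close>
  have "col A' 0 = W *\<^sub>v (A *\<^sub>v col W 0)"
    by (simp only: A'_def assoc_mult_mat[OF W A W] col_mult2[OF W mult_carrier_mat[OF A W] zero_less_Suc]
        col_mult2[OF A W zero_less_Suc])
  also have "\<dots> = r \<cdot>\<^sub>v (W *\<^sub>v col W 0)"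
    using v W by (simp add: W0 mult_mat_vec)
  also have "W *\<^sub>v col W 0 = col (W * W) 0" by (simp only: col_mult2[OF W W zero_less_Suc])
  finally have col0: "col A' 0 = r \<cdot>\<^sub>v col (1\<^sub>m ?n) 0" by (simp add: WW)
  have A'0: "A' $$ (i, 0) = (if i = 0 then r else 0)" if "i < ?n" for i
  proof -
    have "A' $$ (i, 0) = vec_index (col A' 0) i" using A' that by simp
    also have "\<dots> = (if i = 0 then r else 0)" using that by (simp add: col0)
    finally show ?thesis .
  qed
  define A3 where "A3 = Matrix.mat m m (\<lambda>(i, j). A' $$ (Suc i, Suc j))"
  have A3: "A3 \<in> carrier_mat m m" by (simp add: A3_def)
  have symA3: "transpose_mat A3 = A3"
    by (rule eq_matI) (auto simp: A3_def intro!: A'_sym)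
  obtain P d where P: "P \<in> carrier_mat m m" and PP: "transpose_mat P * P = 1\<^sub>m m"
    and A3_eq: "A3 = P * mat_diag m d * transpose_mat P"
    using Suc.IH[OF A3 symA3] by blast
  \<comment> \<open>The block sum of the 1 by 1 identity and \<open>P\<close>; correspondingly
    \<open>d'\<close> is \<open>d\<close> with the eigenvalue \<open>r\<close> put in front.\<close>
  define Q where "Q = Matrix.mat ?n ?n (\<lambda>(i, j). case (i, j) of
      (0, 0) \<Rightarrow> 1 | (Suc i', Suc j') \<Rightarrow> P $$ (i', j') | _ \<Rightarrow> 0)"
  define d' where "d' = (\<lambda>i. case i of 0 \<Rightarrow> r | Suc i' \<Rightarrow> d i')"
  have Q: "Q \<in> carrier_mat ?n ?n" by (simp add: Q_def)
  have QQ: "transpose_mat Q * Q = 1\<^sub>m ?n"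
  proof (rule eq_matI)
    fix i j assume ij: "i < dim_row (1\<^sub>m ?n :: real mat)" "j < dim_col (1\<^sub>m ?n :: real mat)"
    have PPij: "(\<Sum>k<m. P $$ (k, i') * P $$ (k, j')) = of_bool (i' = j')" if "i' < m" "j' < m" for i' j'
    proof -
      have "(\<Sum>k<m. P $$ (k, i') * P $$ (k, j')) = (transpose_mat P * P) $$ (i', j')"
        using P that by (simp add: scalar_prod_def atLeast0LessThan)
      also have "\<dots> = of_bool (i' = j')" using that by (simp add: PP)
      finally show ?thesis .
    qed
    have "(transpose_mat Q * Q) $$ (i, j) = (\<Sum>k<?n. Q $$ (k, i) * Q $$ (k, j))"
      using Q ij by (simp add: scalar_prod_def atLeast0LessThan del: sum.lessThan_Suc)
    also have "\<dots> = 1\<^sub>m ?n $$ (i, j)"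
      using ij unfolding sum.lessThan_Suc_shift
      by (cases i; cases j) (auto simp: Q_def PPij)
    finally show "(transpose_mat Q * Q) $$ (i, j) = 1\<^sub>m ?n $$ (i, j)" .
  qed (use Q in auto)
  have A'_eq: "A' = Q * mat_diag ?n d' * transpose_mat Q"
  proof (rule eq_matI)
    fix i j assume "i < dim_row (Q * mat_diag ?n d' * transpose_mat Q)"
      "j < dim_col (Q * mat_diag ?n d' * transpose_mat Q)"
    then have ij: "i < ?n" "j < ?n" using Q by auto
    have A'S: "A' $$ (Suc i', Suc j') = (\<Sum>k<m. d k * P $$ (i', k) * P $$ (j', k))"
      if "i' < m" "j' < m" for i' j'
    proof -
      have "A' $$ (Suc i', Suc j') = A3 $$ (i', j')" using that by (simp add: A3_def)
      then show ?thesis using that by (simp add: A3_eq index_conj_mat_diag[OF P])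
    qed
    have "A' $$ (i, j) = (\<Sum>k<?n. d' k * Q $$ (i, k) * Q $$ (j, k))"
      using ij unfolding sum.lessThan_Suc_shift
      by (cases i; cases j) (auto simp: Q_def d'_def A'S A'0 A'_sym[of 0])
    then show "A' $$ (i, j) = (Q * mat_diag ?n d' * transpose_mat Q) $$ (i, j)"
      by (simp only: index_conj_mat_diag[OF Q ij])
  qed (use A' Q in auto)
  note assoc = assoc_mult_mat[of _ ?n ?n _ ?n _ ?n]
  have D: "mat_diag ?n d' \<in> carrier_mat ?n ?n" and QT: "transpose_mat Q \<in> carrier_mat ?n ?n"
    using Q by simp_all
  have "A = W * W * A * (W * W)" using A by (simp add: WW)
  also have "\<dots> = W * A' * W" using A W by (simp add: A'_def assoc)
  also have "\<dots> = (W * Q) * mat_diag ?n d' * transpose_mat (W * Q)"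
    using W Q D QT mult_carrier_mat[OF D QT] mult_carrier_mat[OF Q mult_carrier_mat[OF D QT]]
    by (simp add: A'_eq transpose_mult[of _ ?n ?n _ ?n] WT assoc)
  finally have "A = (W * Q) * mat_diag ?n d' * transpose_mat (W * Q)" .
  moreover have "transpose_mat (W * Q) * (W * Q) = 1\<^sub>m ?n"
  proof -
    have "transpose_mat (W * Q) * (W * Q) = transpose_mat Q * ((W * W) * Q)"
      using W Q by (simp add: transpose_mult[of _ ?n ?n _ ?n] WT assoc)
    then show ?thesis using Q by (simp add: WW QQ)
  qed
  ultimately show ?case using W Q by (intro exI[of _ "W * Q"] exI[of _ d']) auto
qed


section \<open>Spectral sums and the trace norm\<close>

text \<open>For symmetric matrices this is the usual trace norm, the sum of the singular values. It
  is phrased through the same multiset as \<open>laplacian_energy\<close>, so that the energy is a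
  trace norm by mere unfolding.\<close>

definition trace_norm :: "real mat \<Rightarrow> real" where
  "trace_norm A = (\<Sum>\<zeta>\<in>#eigenvalues_mset A. cmod \<zeta>)"

text \<open>Similar matrices share their characteristic polynomial, and that of a diagonal matrix is
  a product of linear factors. The factorization is carried from the reals to the complex numbers,
  where the multiset of roots is read off.\<close>

lemma eigenvalues_mset_diagonalization:
  fixes P :: "real mat"
  assumes P: "P \<in> carrier_mat n n" and PP: "transpose_mat P * P = 1\<^sub>m n"
  shows "eigenvalues_mset (P * mat_diag n d * transpose_mat P) =
           image_mset (complex_of_real \<circ> d) (mset [0..<n])"
proof -
  let ?D = "mat_diag n d" and ?A = "P * mat_diag n d * transpose_mat P"
  have PT: "transpose_mat P \<in> carrier_mat n n" using P by simp
  have D: "?D \<in> carrier_mat n n" by simp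
  have A: "?A \<in> carrier_mat n n" using P by auto
  have PP': "P * transpose_mat P = 1\<^sub>m n"
    by (rule mat_mult_left_right_inverse[OF PT P PP])
  have "similar_mat ?A ?D"
    unfolding similar_mat_def
    by (intro exI[of _ P] exI[of _ "transpose_mat P"] similar_mat_witI[of _ _ n]) (use P PT PP PP' A in auto)
  then have "char_poly ?A = char_poly ?D" by (rule char_poly_similar)
  also have "\<dots> = (\<Prod>a\<leftarrow>diag_mat ?D. [:- a, 1:])"
    by (rule char_poly_upper_triangular[OF D]) (auto simp: mat_diag_def)
  also have "diag_mat ?D = map d [0..<n]"
    by (auto simp: diag_mat_def mat_diag_def)
  finally have cp: "char_poly ?A = (\<Prod>a\<leftarrow>map d [0..<n]. [:- a, 1:])" .
  have lin: "map_poly complex_of_real (\<Prod>a\<leftarrow>xs. [:- a, 1:]) = (\<Prod>a\<leftarrow>xs. [:- complex_of_real a, 1:])" for xs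
  proof -
    interpret map_poly_comm_ring_hom complex_of_real ..
    show ?thesis
      by (induction xs) (simp_all add: hom_mult of_real_hom.map_poly_pCons_hom
          del: mult_pCons_left mult_pCons_right)
  qed
  have roots: "proots (\<Prod>a\<leftarrow>xs. [:- a, 1:]) = mset xs" for xs :: "complex list"
  proof (induction xs)
    case (Cons x xs)
    have "(\<Prod>a\<leftarrow>xs. [:- a, 1:]) \<noteq> 0" by (auto simp: prod_list_zero_iff)
    then show ?case using Cons by (simp add: proots_mult del: mult_pCons_left mult_pCons_right)
  qed simp
  have "char_poly (map_mat complex_of_real ?A) = map_poly of_real (char_poly ?A)"
    by (rule of_real_hom.char_poly_hom[OF A])
  also have "\<dots> = (\<Prod>a\<leftarrow>map (complex_of_real \<circ> d) [0..<n]. [:- a, 1:])"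
    using lin[of "map d [0..<n]"] by (simp add: cp o_def)
  finally have "eigenvalues_mset ?A = proots (\<Prod>a\<leftarrow>map (complex_of_real \<circ> d) [0..<n]. [:- a, 1:])"
    by (simp add: eigenvalues_mset_def)
  also have "\<dots> = mset (map (complex_of_real \<circ> d) [0..<n])"
    by (rule roots)
  finally show ?thesis by simp
qed

text \<open>The diagonalization in coordinates: \<open>u i\<close> is the \<open>i\<close>-th
  eigenvector, that is, column \<open>i\<close> of \<open>P\<close>. The two orthogonality relations
  are P^T P = 1 and P P^T = 1; the second one is the completeness relation behind Parseval's
  identity.\<close>

lemma symmetric_spectral_sum:
  fixes A :: "real mat"
  assumes A: "A \<in> carrier_mat n n" and sym: "transpose_mat A = A"
  obtains u :: "nat \<Rightarrow> nat \<Rightarrow> real" and d where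
    "\<And>i j. i < n \<Longrightarrow> j < n \<Longrightarrow> (\<Sum>k<n. u i k * u j k) = of_bool (i = j)"
    "\<And>k l. k < n \<Longrightarrow> l < n \<Longrightarrow> (\<Sum>i<n. u i k * u i l) = of_bool (k = l)"
    "\<And>k l. k < n \<Longrightarrow> l < n \<Longrightarrow> A $$ (k, l) = (\<Sum>i<n. d i * u i k * u i l)"
    "trace_norm A = (\<Sum>i<n. \<bar>d i\<bar>)"
proof -
  obtain P d where P: "P \<in> carrier_mat n n" and PP: "transpose_mat P * P = 1\<^sub>m n"
    and A_eq: "A = P * mat_diag n d * transpose_mat P"
    using symmetric_mat_diagonalization[OF assms] by blast
  have PT: "transpose_mat P \<in> carrier_mat n n" using P by simp
  have PP': "P * transpose_mat P = 1\<^sub>m n"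
    by (rule mat_mult_left_right_inverse[OF PT P PP])
  show ?thesis
  proof (rule that[of "\<lambda>i k. P $$ (k, i)" d])
    fix i j assume ij: "i < n" "j < n"
    have "(\<Sum>k<n. P $$ (k, i) * P $$ (k, j)) = (transpose_mat P * P) $$ (i, j)"
      using P ij by (simp add: scalar_prod_def atLeast0LessThan)
    also have "\<dots> = of_bool (i = j)" using ij by (simp add: PP)
    finally show "(\<Sum>k<n. P $$ (k, i) * P $$ (k, j)) = of_bool (i = j)" .
    have "(\<Sum>k<n. P $$ (i, k) * P $$ (j, k)) = (P * transpose_mat P) $$ (i, j)"
      using P ij by (simp add: scalar_prod_def atLeast0LessThan)
    also have "\<dots> = of_bool (i = j)" using ij by (simp add: PP')
    finally show "(\<Sum>k<n. P $$ (i, k) * P $$ (j, k)) = of_bool (i = j)" .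
    show "A $$ (i, j) = (\<Sum>k<n. d k * P $$ (i, k) * P $$ (j, k))"
      unfolding A_eq by (rule index_conj_mat_diag[OF P ij])
  next
    show "trace_norm A = (\<Sum>i<n. \<bar>d i\<bar>)"
      unfolding trace_norm_def A_eq eigenvalues_mset_diagonalization[OF P PP]
      by (simp add: image_mset.compositionality o_def sum_unfold_sum_mset atLeast0LessThan flip: mset_map)
  qed
qed

lemma sum_sum_factor:
  fixes c :: "'a :: comm_semiring_0"
  shows "(\<Sum>k\<in>K. \<Sum>l\<in>L. c * (f k * g l)) = c * (sum f K * sum g L)"
  unfolding sum_product by (simp only: sum_distrib_left)

text \<open>The squared Frobenius norm is the sum of the squared eigenvalues: after expansion,
  summing over \<open>k\<close> and \<open>l\<close> leaves products of inner products of
  eigenvectors, which vanish for different eigenvectors. The entries are a function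
  \<open>C\<close>, so that the entries of a matrix product fit as well.\<close>

lemma sum_square_spectral_sum:
  fixes u :: "nat \<Rightarrow> nat \<Rightarrow> real"
  assumes orth: "\<And>i j. i < n \<Longrightarrow> j < n \<Longrightarrow> (\<Sum>k<n. u i k * u j k) = of_bool (i = j)"
    and C: "\<And>k l. k < n \<Longrightarrow> l < n \<Longrightarrow> C k l = (\<Sum>i<n. m i * u i k * u i l)"
  shows "(\<Sum>k<n. \<Sum>l<n. (C k l)\<^sup>2) = (\<Sum>i<n. (m i)\<^sup>2)"
proof -
  have "(\<Sum>k<n. \<Sum>l<n. (C k l)\<^sup>2) =
        (\<Sum>k<n. \<Sum>l<n. \<Sum>i<n. \<Sum>j<n. m i * m j * ((u i k * u j k) * (u i l * u j l)))"
    using C by (simp add: power2_eq_square sum_product mult_ac)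
  also have "\<dots> = (\<Sum>k<n. \<Sum>i<n. \<Sum>l<n. \<Sum>j<n. m i * m j * ((u i k * u j k) * (u i l * u j l)))"
    by (intro sum.cong refl sum.swap)
  also have "\<dots> = (\<Sum>i<n. \<Sum>k<n. \<Sum>j<n. \<Sum>l<n. m i * m j * ((u i k * u j k) * (u i l * u j l)))"
    by (subst sum.swap) (intro sum.cong refl sum.swap)
  also have "\<dots> = (\<Sum>i<n. \<Sum>j<n. \<Sum>k<n. \<Sum>l<n. m i * m j * ((u i k * u j k) * (u i l * u j l)))"
    by (intro sum.cong refl sum.swap)
  also have "\<dots> = (\<Sum>i<n. \<Sum>j<n. m i * m j * ((\<Sum>k<n. u i k * u j k) * (\<Sum>l<n. u i l * u j l)))"
    by (simp only: sum_sum_factor)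
  also have "\<dots> = (\<Sum>i<n. \<Sum>j<n. if i = j then m i * m j else 0)"
    by (intro sum.cong refl) (simp add: orth)
  also have "\<dots> = (\<Sum>i<n. (m i)\<^sup>2)" by (simp add: power2_eq_square)
  finally show ?thesis .
qed

text \<open>A triangle inequality for the trace norm. Each eigenvalue is d_i = u_i^T A u_i, hence
  the sum of c_r times the squared inner product \<open>g i r\<close> of u_i and w_r. Take absolute
  values, sum over \<open>i\<close>, and apply Parseval to each w_r.\<close>

lemma trace_norm_rank_one_sum_le:
  fixes A :: "real mat" and w :: "'r \<Rightarrow> nat \<Rightarrow> real"
  assumes A: "A \<in> carrier_mat n n" and sym: "transpose_mat A = A"
    and A_eq: "\<And>k l. k < n \<Longrightarrow> l < n \<Longrightarrow> A $$ (k, l) = (\<Sum>r\<in>R. c r * w r k * w r l)"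
  shows "trace_norm A \<le> (\<Sum>r\<in>R. \<bar>c r\<bar> * (\<Sum>k<n. (w r k)\<^sup>2))"
proof -
  obtain u d where orth1: "\<And>i j. i < n \<Longrightarrow> j < n \<Longrightarrow> (\<Sum>k<n. u i k * u j k) = of_bool (i = j)"
    and orth2: "\<And>k l. k < n \<Longrightarrow> l < n \<Longrightarrow> (\<Sum>i<n. u i k * u i l) = of_bool (k = l)"
    and dec: "\<And>k l. k < n \<Longrightarrow> l < n \<Longrightarrow> A $$ (k, l) = (\<Sum>i<n. d i * u i k * u i l)"
    and tn: "trace_norm A = (\<Sum>i<n. \<bar>d i\<bar>)"
    using symmetric_spectral_sum[OF A sym] by blast
  define g where "g i r = (\<Sum>k<n. u i k * w r k)" for i r
  have d: "d i = (\<Sum>r\<in>R. c r * (g i r)\<^sup>2)" if i: "i < n" for i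
  proof -
    have "(\<Sum>k<n. \<Sum>l<n. u i k * A $$ (k, l) * u i l) =
          (\<Sum>k<n. \<Sum>l<n. \<Sum>j<n. d j * ((u i k * u j k) * (u i l * u j l)))"
      using dec by (simp add: sum_distrib_left sum_distrib_right mult_ac)
    also have "\<dots> = (\<Sum>k<n. \<Sum>j<n. \<Sum>l<n. d j * ((u i k * u j k) * (u i l * u j l)))"
      by (intro sum.cong refl sum.swap)
    also have "\<dots> = (\<Sum>j<n. \<Sum>k<n. \<Sum>l<n. d j * ((u i k * u j k) * (u i l * u j l)))"
      by (rule sum.swap)
    also have "\<dots> = (\<Sum>j<n. d j * ((\<Sum>k<n. u i k * u j k) * (\<Sum>l<n. u i l * u j l)))"
      by (simp only: sum_sum_factor)
    also have "\<dots> = (\<Sum>j<n. if i = j then d j else 0)"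
      using i by (intro sum.cong refl) (simp add: orth1)
    also have "\<dots> = d i" using i by simp
    finally have "d i = (\<Sum>k<n. \<Sum>l<n. u i k * A $$ (k, l) * u i l)" by simp
    also have "\<dots> = (\<Sum>k<n. \<Sum>l<n. \<Sum>r\<in>R. c r * ((u i k * w r k) * (u i l * w r l)))"
      using A_eq by (simp add: sum_distrib_left sum_distrib_right mult_ac)
    also have "\<dots> = (\<Sum>k<n. \<Sum>r\<in>R. \<Sum>l<n. c r * ((u i k * w r k) * (u i l * w r l)))"
      by (intro sum.cong refl sum.swap)
    also have "\<dots> = (\<Sum>r\<in>R. \<Sum>k<n. \<Sum>l<n. c r * ((u i k * w r k) * (u i l * w r l)))"
      by (rule sum.swap)
    also have "\<dots> = (\<Sum>r\<in>R. c r * (g i r)\<^sup>2)"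
      unfolding g_def power2_eq_square by (simp only: sum_sum_factor)
    finally show ?thesis .
  qed
  have parseval: "(\<Sum>i<n. (g i r)\<^sup>2) = (\<Sum>k<n. (w r k)\<^sup>2)" for r
  proof -
    have "(\<Sum>i<n. (g i r)\<^sup>2) = (\<Sum>i<n. \<Sum>k<n. \<Sum>l<n. w r k * w r l * (u i k * u i l))"
      unfolding g_def power2_eq_square by (simp add: sum_product mult_ac)
    also have "\<dots> = (\<Sum>k<n. \<Sum>i<n. \<Sum>l<n. w r k * w r l * (u i k * u i l))"
      by (rule sum.swap)
    also have "\<dots> = (\<Sum>k<n. \<Sum>l<n. \<Sum>i<n. w r k * w r l * (u i k * u i l))"
      by (intro sum.cong refl sum.swap)
    also have "\<dots> = (\<Sum>k<n. \<Sum>l<n. if k = l then w r k * w r l else 0)"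
      by (intro sum.cong refl) (simp add: orth2 flip: sum_distrib_left)
    also have "\<dots> = (\<Sum>k<n. (w r k)\<^sup>2)" by (simp add: power2_eq_square)
    finally show ?thesis .
  qed
  have "trace_norm A \<le> (\<Sum>i<n. \<Sum>r\<in>R. \<bar>c r\<bar> * (g i r)\<^sup>2)"
    unfolding tn
  proof (rule sum_mono)
    fix i assume "i \<in> {..<n}"
    then show "\<bar>d i\<bar> \<le> (\<Sum>r\<in>R. \<bar>c r\<bar> * (g i r)\<^sup>2)"
      using sum_abs[of "\<lambda>r. c r * (g i r)\<^sup>2" R] by (simp add: d abs_mult)
  qed
  also have "\<dots> = (\<Sum>r\<in>R. \<Sum>i<n. \<bar>c r\<bar> * (g i r)\<^sup>2)" by (rule sum.swap)
  also have "\<dots> = (\<Sum>r\<in>R. \<bar>c r\<bar> * (\<Sum>k<n. (w r k)\<^sup>2))"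
    by (simp add: parseval flip: sum_distrib_left)
  finally show ?thesis .
qed

lemma trace_norm_perturbation_le:
  fixes A B :: "real mat" and w :: "'r \<Rightarrow> nat \<Rightarrow> real"
  assumes A: "A \<in> carrier_mat n n" and symA: "transpose_mat A = A"
    and B: "B \<in> carrier_mat n n" and symB: "transpose_mat B = B" and R: "finite R"
    and AB: "\<And>k l. k < n \<Longrightarrow> l < n \<Longrightarrow> A $$ (k, l) = B $$ (k, l) + (\<Sum>r\<in>R. c r * w r k * w r l)"
  shows "trace_norm A \<le> trace_norm B + (\<Sum>r\<in>R. \<bar>c r\<bar> * (\<Sum>k<n. (w r k)\<^sup>2))"
proof -
  obtain u d where orth: "\<And>i j. i < n \<Longrightarrow> j < n \<Longrightarrow> (\<Sum>k<n. u i k * u j k) = of_bool (i = j)"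
    and "\<And>k l. k < n \<Longrightarrow> l < n \<Longrightarrow> (\<Sum>i<n. u i k * u i l) = of_bool (k = l)"
    and dec: "\<And>k l. k < n \<Longrightarrow> l < n \<Longrightarrow> B $$ (k, l) = (\<Sum>i<n. d i * u i k * u i l)"
    and tn: "trace_norm B = (\<Sum>i<n. \<bar>d i\<bar>)"
    using symmetric_spectral_sum[OF B symB] by blast
  \<comment> \<open>The spectral decomposition of \<open>B\<close> is itself a sum of rank-one terms of total size \<open>trace_norm B\<close>.\<close>
  have "trace_norm A \<le> (\<Sum>r\<in>{..<n} <+> R. \<bar>case_sum d c r\<bar> * (\<Sum>k<n. (case_sum u w r k)\<^sup>2))"
    by (rule trace_norm_rank_one_sum_le[OF A symA]) (simp add: AB dec R sum.Plus)
  also have "\<dots> = trace_norm B + (\<Sum>r\<in>R. \<bar>c r\<bar> * (\<Sum>k<n. (w r k)\<^sup>2))"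
    by (simp add: R sum.Plus tn orth power2_eq_square)
  finally show ?thesis .
qed

lemma abs_le_quadratic:
  fixes x t :: real
  assumes "t > 0"
  shows "\<bar>x\<bar> \<le> x\<^sup>2 / (2 * t) + t / 2"
proof -
  have "0 \<le> (\<bar>x\<bar> - t)\<^sup>2" by simp
  then have "2 * t * \<bar>x\<bar> \<le> x\<^sup>2 + t * t" by (simp add: power2_diff power2_eq_square algebra_simps)
  then show ?thesis using assms by (simp add: field_simps power2_eq_square)
qed

lemma abs_ge_quartic:
  fixes x t :: real
  assumes t: "t > 0"
  shows "\<bar>x\<bar> \<ge> 3 / (2 * t) * x\<^sup>2 - 1 / (2 * t ^ 3) * (x\<^sup>2)\<^sup>2"
proof -
  \<comment> \<open>With \<open>y = \<bar>x\<bar> / t\<close> this is \<open>(y - 1)\<^sup>2 (y + 2) \<ge> 0\<close>.\<close>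
  define y where "y = \<bar>x\<bar> / t"
  have y: "y \<ge> 0" using t by (simp add: y_def)
  have x: "\<bar>x\<bar> = t * y" using t by (simp add: y_def)
  then have x2: "x\<^sup>2 = (t * y)\<^sup>2" by (metis power2_abs)
  have "0 \<le> t * ((y - 1)\<^sup>2 * (y + 2) * y)" using y t by simp
  also have "\<dots> = 2 * (t * y) - (3 * (t * y ^ 2) - t * y ^ 4)"
    by (simp add: power2_eq_square power4_eq_xxxx algebra_simps)
  finally have "t * y \<ge> (3 * (t * y ^ 2) - t * y ^ 4) / 2" by simp
  moreover have "3 / (2 * t) * x\<^sup>2 = 3 * (t * y ^ 2) / 2"
    unfolding x2 using t by (simp add: power2_eq_square field_simps)
  moreover have "1 / (2 * t ^ 3) * (x\<^sup>2)\<^sup>2 = t * y ^ 4 / 2"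
    unfolding x2 using t by (simp add: power2_eq_square power3_eq_cube power4_eq_xxxx field_simps)
  ultimately show ?thesis unfolding x by (simp add: diff_divide_distrib)
qed

lemma trace_norm_bounds:
  fixes A :: "real mat"
  assumes A: "A \<in> carrier_mat n n" and sym: "transpose_mat A = A" and t: "t > 0"
  shows "trace_norm A \<le> (\<Sum>k<n. \<Sum>l<n. (A $$ (k, l))\<^sup>2) / (2 * t) + real n * t / 2" (is ?upper)
    and "3 / (2 * t) * (\<Sum>k<n. \<Sum>l<n. (A $$ (k, l))\<^sup>2) -
         1 / (2 * t ^ 3) * (\<Sum>k<n. \<Sum>l<n. (\<Sum>r<n. A $$ (k, r) * A $$ (r, l))\<^sup>2) \<le> trace_norm A"
      (is ?lower)
proof -
  obtain u d where orth: "\<And>i j. i < n \<Longrightarrow> j < n \<Longrightarrow> (\<Sum>k<n. u i k * u j k) = of_bool (i = j)"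
    and "\<And>k l. k < n \<Longrightarrow> l < n \<Longrightarrow> (\<Sum>i<n. u i k * u i l) = of_bool (k = l)"
    and dec: "\<And>k l. k < n \<Longrightarrow> l < n \<Longrightarrow> A $$ (k, l) = (\<Sum>i<n. d i * u i k * u i l)"
    and tn: "trace_norm A = (\<Sum>i<n. \<bar>d i\<bar>)"
    using symmetric_spectral_sum[OF A sym] by blast
  have sq: "(\<Sum>k<n. \<Sum>l<n. (A $$ (k, l))\<^sup>2) = (\<Sum>i<n. (d i)\<^sup>2)"
    by (rule sum_square_spectral_sum[OF orth dec])
  \<comment> \<open>The square of the matrix has the same eigenvectors, with squared
    eigenvalues.\<close>
  have dec2: "(\<Sum>r<n. A $$ (k, r) * A $$ (r, l)) = (\<Sum>i<n. (d i)\<^sup>2 * u i k * u i l)"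
    if kl: "k < n" "l < n" for k l
  proof -
    have "(\<Sum>r<n. A $$ (k, r) * A $$ (r, l)) =
          (\<Sum>r<n. \<Sum>i<n. \<Sum>j<n. d i * d j * u i k * u j l * (u i r * u j r))"
      using kl by (simp add: dec sum_product mult_ac)
    also have "\<dots> = (\<Sum>i<n. \<Sum>r<n. \<Sum>j<n. d i * d j * u i k * u j l * (u i r * u j r))"
      by (rule sum.swap)
    also have "\<dots> = (\<Sum>i<n. \<Sum>j<n. \<Sum>r<n. d i * d j * u i k * u j l * (u i r * u j r))"
      by (intro sum.cong refl sum.swap)
    also have "\<dots> = (\<Sum>i<n. \<Sum>j<n. if i = j then d i * d j * u i k * u j l else 0)"
      by (intro sum.cong refl) (simp add: orth flip: sum_distrib_left)
    also have "\<dots> = (\<Sum>i<n. (d i)\<^sup>2 * u i k * u i l)" by (simp add: power2_eq_square)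
    finally show ?thesis .
  qed
  have quart: "(\<Sum>k<n. \<Sum>l<n. (\<Sum>r<n. A $$ (k, r) * A $$ (r, l))\<^sup>2) = (\<Sum>i<n. ((d i)\<^sup>2)\<^sup>2)"
    by (rule sum_square_spectral_sum[OF orth dec2])
  have "trace_norm A \<le> (\<Sum>i<n. (d i)\<^sup>2 / (2 * t) + t / 2)"
    unfolding tn by (intro sum_mono abs_le_quadratic t)
  then show ?upper by (simp add: sq sum.distrib sum_divide_distrib)
  have "(\<Sum>i<n. 3 / (2 * t) * (d i)\<^sup>2 - 1 / (2 * t ^ 3) * ((d i)\<^sup>2)\<^sup>2) \<le> trace_norm A"
    unfolding tn by (intro sum_mono abs_ge_quartic t)
  then show ?lower by (simp only: sq quart sum_subtractf sum_distrib_left)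
qed

section \<open>Functions of independent Bernoulli variables\<close>

lemma finite_set_Pi_bernoulli:
  assumes "finite I"
  shows "finite (set_pmf (Pi_pmf I False (\<lambda>_. bernoulli_pmf p)))"
  using assms by (auto simp: set_Pi_pmf intro!: finite_PiE_dflt)

lemma expectation_Pi_bernoulli_insert:
  fixes f :: "('e \<Rightarrow> bool) \<Rightarrow> real"
  assumes I: "finite I" "e \<notin> I" and p: "0 \<le> p" "p \<le> 1"
  defines "Q \<equiv> Pi_pmf I False (\<lambda>_. bernoulli_pmf p)"
  shows "measure_pmf.expectation (Pi_pmf (insert e I) False (\<lambda>_. bernoulli_pmf p)) f =
     measure_pmf.expectation Q (\<lambda>x. p * f (x(e := True)) + (1 - p) * f (x(e := False)))"
proof -
  have fin: "finite (set_pmf Q)" unfolding Q_def by (rule finite_set_Pi_bernoulli[OF I(1)])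
  have int: "integrable (measure_pmf Q) g" for g :: "_ \<Rightarrow> real"
    by (rule integrable_measure_pmf_finite[OF fin])
  have eq: "Pi_pmf (insert e I) False (\<lambda>_. bernoulli_pmf p) =
        bernoulli_pmf p \<bind> (\<lambda>b. map_pmf (\<lambda>x. x(e := b)) Q)"
    by (simp add: Pi_pmf_insert'[OF I] Q_def map_pmf_def)
  have "measure_pmf.expectation (Pi_pmf (insert e I) False (\<lambda>_. bernoulli_pmf p)) f =
        (\<Sum>b\<in>UNIV. pmf (bernoulli_pmf p) b *\<^sub>R measure_pmf.expectation (map_pmf (\<lambda>x. x(e := b)) Q) f)"
    unfolding eq using fin by (intro pmf_expectation_bind) auto
  also have "\<dots> = p * measure_pmf.expectation Q (\<lambda>x. f (x(e := True))) +
                   (1 - p) * measure_pmf.expectation Q (\<lambda>x. f (x(e := False)))"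
    using p by (simp add: UNIV_bool)
  also have "\<dots> = measure_pmf.expectation Q (\<lambda>x. p * f (x(e := True)) + (1 - p) * f (x(e := False)))"
    using int by (simp add: Bochner_Integration.integral_add)
  finally show ?thesis .
qed

text \<open>An Efron-Stein bound, by induction on the coordinates. Averaging \<open>f\<close> over
  the coordinate \<open>e\<close> gives a function \<open>g\<close> with the same mean and the same
  Lipschitz constant, and the variance lost in the averaging is at most c^2. The claim is general in
  \<open>f\<close> because the induction step passes to \<open>g\<close>.\<close>

lemma variance_lipschitz_Pi_bernoulli:
  fixes f :: "('e \<Rightarrow> bool) \<Rightarrow> real"
  assumes I: "finite I" and p: "0 \<le> p" "p \<le> 1"
    and lip: "\<And>e x. e \<in> I \<Longrightarrow> \<bar>f (x(e := True)) - f (x(e := False))\<bar> \<le> c"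
  defines "Q \<equiv> \<lambda>I. Pi_pmf I False (\<lambda>_. bernoulli_pmf p)"
  shows "measure_pmf.expectation (Q I) (\<lambda>x. (f x - measure_pmf.expectation (Q I) f)\<^sup>2) \<le> real (card I) * c\<^sup>2"
  using I lip
proof (induction I arbitrary: f rule: finite_induct)
  case empty
  then show ?case by (simp add: Q_def)
next
  case (insert e I)
  have fin: "finite (set_pmf (Q I))" unfolding Q_def by (rule finite_set_Pi_bernoulli[OF insert.hyps(1)])
  have int: "integrable (measure_pmf (Q I)) g" for g :: "_ \<Rightarrow> real"
    by (rule integrable_measure_pmf_finite[OF fin])
  define g where "g x = p * f (x(e := True)) + (1 - p) * f (x(e := False))" for x
  have step: "measure_pmf.expectation (Q (insert e I)) h =
       measure_pmf.expectation (Q I) (\<lambda>x. p * h (x(e := True)) + (1 - p) * h (x(e := False)))"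
    for h :: "_ \<Rightarrow> real"
    unfolding Q_def by (rule expectation_Pi_bernoulli_insert[OF insert.hyps p])
  define \<mu> where "\<mu> = measure_pmf.expectation (Q I) g"
  have \<mu>: "measure_pmf.expectation (Q (insert e I)) f = \<mu>"
    by (simp only: step \<mu>_def g_def[abs_def])
  have lip_g: "\<bar>g (x(e' := True)) - g (x(e' := False))\<bar> \<le> c" if e': "e' \<in> I" for e' x
  proof -
    have ne: "e \<noteq> e'" using e' insert.hyps by auto
    have "\<bar>g (x(e' := True)) - g (x(e' := False))\<bar> =
       \<bar>p * (f (x(e := True, e' := True)) - f (x(e := True, e' := False))) +
        (1 - p) * (f (x(e := False, e' := True)) - f (x(e := False, e' := False)))\<bar>"
      unfolding g_def using ne by (simp add: fun_upd_twist algebra_simps)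
    also have "\<dots> \<le> p * \<bar>f (x(e := True, e' := True)) - f (x(e := True, e' := False))\<bar> +
        (1 - p) * \<bar>f (x(e := False, e' := True)) - f (x(e := False, e' := False))\<bar>"
      using p by (intro order_trans[OF abs_triangle_ineq]) (simp add: abs_mult)
    also have "\<dots> \<le> p * c + (1 - p) * c"
      using p e' by (intro add_mono mult_left_mono insert.prems) auto
    finally show ?thesis by (simp add: algebra_simps)
  qed
  have pt: "p * (f (x(e := True)) - \<mu>)\<^sup>2 + (1 - p) * (f (x(e := False)) - \<mu>)\<^sup>2 \<le> (g x - \<mu>)\<^sup>2 + c\<^sup>2" for x
  proof -
    let ?d = "f (x(e := True)) - f (x(e := False))"
    \<comment> \<open>Mean and variance of a two-point variable: its mean is \<open>g x\<close> and
      its variance is p (1 - p) times the squared gap between its values.\<close>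
    have "p * (f (x(e := True)) - \<mu>)\<^sup>2 + (1 - p) * (f (x(e := False)) - \<mu>)\<^sup>2 =
          (g x - \<mu>)\<^sup>2 + p * (1 - p) * ?d\<^sup>2"
      unfolding g_def by (simp add: power2_eq_square algebra_simps)
    moreover have "p * (1 - p) * ?d\<^sup>2 \<le> 1 * c\<^sup>2"
    proof (intro mult_mono)
      show "p * (1 - p) \<le> 1" using p by (intro mult_le_one) auto
      show "?d\<^sup>2 \<le> c\<^sup>2" using power_mono[OF insert.prems[OF insertI1, of x] abs_ge_zero, of 2]
        by (simp only: power2_abs)
    qed auto
    ultimately show ?thesis by simp
  qed
  have "measure_pmf.expectation (Q (insert e I)) (\<lambda>x. (f x - \<mu>)\<^sup>2) \<le>
        measure_pmf.expectation (Q I) (\<lambda>x. (g x - \<mu>)\<^sup>2 + c\<^sup>2)"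
    unfolding step by (intro integral_mono int pt)
  also have "\<dots> = measure_pmf.expectation (Q I) (\<lambda>x. (g x - \<mu>)\<^sup>2) + c\<^sup>2"
    using int by (simp add: Bochner_Integration.integral_add)
  also have "\<dots> \<le> real (card I) * c\<^sup>2 + c\<^sup>2"
    using insert.IH[of g, OF lip_g] by (simp add: \<mu>_def)
  finally show ?case using insert.hyps by (simp add: \<mu> algebra_simps)
qed

section \<open>Moments of sums of centered bits\<close>

locale bernoulli_family =
  fixes I :: "'e set" and p :: real
  assumes finite_I: "finite I" and p_bounds: "0 \<le> p" "p \<le> 1"
begin

definition product_law :: "('e \<Rightarrow> bool) pmf" where
  "product_law = Pi_pmf I False (\<lambda>_. bernoulli_pmf p)"

abbreviation expect :: "(('e \<Rightarrow> bool) \<Rightarrow> real) \<Rightarrow> real" where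
  "expect \<equiv> measure_pmf.expectation product_law"

lemma finite_product_law: "finite (set_pmf product_law)"
  unfolding product_law_def by (rule finite_set_Pi_bernoulli[OF finite_I])

lemma integrable_product_law [simp]: "integrable (measure_pmf product_law) (f :: _ \<Rightarrow> real)"
  by (rule integrable_measure_pmf_finite[OF finite_product_law])

lemma expect_mono: "(\<And>x. f x \<le> g x) \<Longrightarrow> expect f \<le> expect g"
  by (intro integral_mono) auto

text \<open>Redrawing a single coordinate leaves the product law unchanged. Independence enters the
  moment computations only in this form.\<close>

lemma expect_resample:
  assumes "e \<in> I"
  shows "expect f = expect (\<lambda>x. p * f (x(e := True)) + (1 - p) * f (x(e := False)))"
proof -
  define J where "J = I - {e}"
  have J: "finite J" "e \<notin> J" "I = insert e J" using finite_I assms by (auto simp: J_def)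
  have ins: "expect h = measure_pmf.expectation (Pi_pmf J False (\<lambda>_. bernoulli_pmf p))
      (\<lambda>x. p * h (x(e := True)) + (1 - p) * h (x(e := False)))" for h
    unfolding product_law_def by (subst J(3)) (rule expectation_Pi_bernoulli_insert[OF J(1,2) p_bounds])
  show ?thesis unfolding ins by (simp add: algebra_simps)
qed

text \<open>That \<open>g\<close> does not depend on the bit \<open>e\<close> is expressed as
  invariance under updates at \<open>e\<close>; redrawing that bit then averages \<open>h\<close>
  alone.\<close>

lemma expect_mult_indep:
  assumes "e \<in> I" and "\<And>x b. g (x(e := b)) = g x"
  shows "expect (\<lambda>x. h (x e) * g x) = (p * h True + (1 - p) * h False) * expect g"
proof -
  have "expect (\<lambda>x. h (x e) * g x) = expect (\<lambda>x. (p * h True + (1 - p) * h False) * g x)"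
    by (subst expect_resample[OF assms(1)]) (simp add: assms(2) algebra_simps)
  then show ?thesis by simp
qed

definition centered :: "'e \<Rightarrow> ('e \<Rightarrow> bool) \<Rightarrow> real" where
  "centered e x = of_bool (x e) - p"

text \<open>The variance of one bit, the square of \<open>\<sigma>\<close> in the theorem.\<close>

definition variance :: real where
  "variance = p * (1 - p)"

lemma variance_nonneg: "0 \<le> variance" and variance_le_1: "variance \<le> 1"
  using p_bounds by (auto simp: variance_def intro: mult_le_one)

lemma centered_upd_other [simp]: "e \<noteq> e' \<Longrightarrow> centered e (x(e' := b)) = centered e x"
  by (simp add: centered_def)

lemma centered_power4_le_1: "centered e x ^ 4 \<le> 1"
proof -
  have "\<bar>centered e x\<bar> ^ 4 \<le> 1"
    using p_bounds by (intro power_le_one) (auto simp: centered_def of_bool_def)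
  then show ?thesis by simp
qed

lemma expect_centered_mult:
  assumes "e \<in> I" and "\<And>x b. g (x(e := b)) = g x"
  shows "expect (\<lambda>x. centered e x * g x) = 0"
  using expect_mult_indep[where h = "\<lambda>b. of_bool b - p", OF assms]
  by (simp add: centered_def algebra_simps)

lemma expect_centered2_mult:
  assumes "e \<in> I" and "\<And>x b. g (x(e := b)) = g x"
  shows "expect (\<lambda>x. (centered e x)\<^sup>2 * g x) = variance * expect g"
proof -
  have "p * (of_bool True - p)\<^sup>2 + (1 - p) * (of_bool False - p)\<^sup>2 = variance"
    by (simp add: variance_def power2_eq_square algebra_simps)
  then show ?thesis
    using expect_mult_indep[where h = "\<lambda>b. (of_bool b - p)\<^sup>2", OF assms]
    by (simp add: centered_def)
qed

text \<open>The third moment of a centered bit vanishes only for symmetric or degenerate bits, so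
  here it is the mean of the cofactor that annihilates the product.\<close>

lemma expect_centered3_mult:
  assumes "e \<in> I" and "\<And>x b. g (x(e := b)) = g x" and "expect g = 0"
  shows "expect (\<lambda>x. centered e x ^ 3 * g x) = 0"
  using expect_mult_indep[where h = "\<lambda>b. (of_bool b - p) ^ 3", OF assms(1,2)] assms(3)
  by (simp add: centered_def)

definition csum :: "'e set \<Rightarrow> ('e \<Rightarrow> bool) \<Rightarrow> real" where
  "csum F x = (\<Sum>e\<in>F. centered e x)"

lemma csum_upd_other [simp]: "e \<notin> F \<Longrightarrow> csum F (x(e := b)) = csum F x"
  unfolding csum_def by (intro sum.cong refl centered_upd_other) auto

lemma csum_remove:
  assumes "F \<subseteq> I" "e \<in> F"
  shows "csum F x = centered e x + csum (F - {e}) x"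
  using assms finite_subset[OF _ finite_I] unfolding csum_def by (subst sum.remove[of F e]) auto

lemma expect_csum:
  assumes "F \<subseteq> I"
  shows "expect (csum F) = 0"
proof -
  have "expect (centered e) = 0" if "e \<in> F" for e
    using expect_centered_mult[of e "\<lambda>_. 1"] assms that by auto
  then show ?thesis by (simp add: csum_def[abs_def] Bochner_Integration.integral_sum)
qed

lemma expect_csum_power2:
  assumes "F \<subseteq> I"
  shows "expect (\<lambda>x. (csum F x)\<^sup>2) = variance * real (card F)"
proof -
  have "finite F" using assms finite_I by (rule finite_subset)
  then show ?thesis using assms
  proof (induction F rule: finite_induct)
    case empty
    then show ?case by (simp add: csum_def)
  next
    case (insert e F)
    have "expect (\<lambda>x. (csum (insert e F) x)\<^sup>2) =
          expect (\<lambda>x. (centered e x)\<^sup>2 * 1 + centered e x * (2 * csum F x) + (csum F x)\<^sup>2)"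
      using insert.hyps by (simp add: csum_def power2_eq_square algebra_simps)
    also have "\<dots> = expect (\<lambda>x. (centered e x)\<^sup>2 * 1) + expect (\<lambda>x. centered e x * (2 * csum F x))
        + expect (\<lambda>x. (csum F x)\<^sup>2)"
      by (simp only: Bochner_Integration.integral_add integrable_product_law)
    also have "\<dots> = variance + variance * real (card F)"
      using insert by (subst expect_centered2_mult, simp, simp, subst expect_centered_mult) auto
    finally show ?case using insert.hyps by (simp add: algebra_simps)
  qed
qed

text \<open>Adding one bit \<open>e\<close> and expanding binomially, both odd terms vanish: the
  cubic one because \<open>csum F\<close> has mean 0, the linear one because \<open>e\<close> is
  centered. The square term contributes 6 v^2 |F| with v = \<open>variance\<close>, which fits into
  the increment of 3 v^2 |F|^2, and the fourth power is at most 1.\<close>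

lemma expect_csum_power4_le:
  assumes "F \<subseteq> I"
  shows "expect (\<lambda>x. csum F x ^ 4) \<le> 3 * variance\<^sup>2 * (real (card F))\<^sup>2 + real (card F)"
proof -
  have "finite F" using assms finite_I by (rule finite_subset)
  then show ?thesis using assms
  proof (induction F rule: finite_induct)
    case empty
    then show ?case by (simp add: csum_def)
  next
    case (insert e F)
    have F: "F \<subseteq> I" and e: "e \<in> I" "e \<notin> F" using insert by auto
    have "expect (\<lambda>x. csum (insert e F) x ^ 4) =
      expect (\<lambda>x. centered e x ^ 4 + centered e x ^ 3 * (4 * csum F x) +
        (centered e x)\<^sup>2 * (6 * (csum F x)\<^sup>2) + centered e x * (4 * csum F x ^ 3) + csum F x ^ 4)"
      using insert.hyps
      by (simp add: csum_def power2_eq_square power3_eq_cube power4_eq_xxxx algebra_simps)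
    also have "\<dots> = expect (\<lambda>x. centered e x ^ 4) + expect (\<lambda>x. centered e x ^ 3 * (4 * csum F x)) +
        expect (\<lambda>x. (centered e x)\<^sup>2 * (6 * (csum F x)\<^sup>2)) +
        expect (\<lambda>x. centered e x * (4 * csum F x ^ 3)) + expect (\<lambda>x. csum F x ^ 4)"
      by (simp only: Bochner_Integration.integral_add integrable_product_law)
    also have "expect (\<lambda>x. centered e x ^ 3 * (4 * csum F x)) = 0"
      using e by (intro expect_centered3_mult) (auto simp: expect_csum[OF F])
    also have "expect (\<lambda>x. (centered e x)\<^sup>2 * (6 * (csum F x)\<^sup>2)) = variance * (6 * (variance * real (card F)))"
      using e by (subst expect_centered2_mult) (auto simp: expect_csum_power2[OF F])
    also have "expect (\<lambda>x. centered e x * (4 * csum F x ^ 3)) = 0"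
      using e by (intro expect_centered_mult) auto
    also have "expect (\<lambda>x. centered e x ^ 4) \<le> expect (\<lambda>_. 1)"
      by (intro expect_mono centered_power4_le_1)
    finally have "expect (\<lambda>x. csum (insert e F) x ^ 4) \<le>
        1 + 6 * variance\<^sup>2 * real (card F) + expect (\<lambda>x. csum F x ^ 4)"
      by (simp add: power2_eq_square)
    also have "\<dots> \<le> 1 + 6 * variance\<^sup>2 * real (card F) + (3 * variance\<^sup>2 * (real (card F))\<^sup>2 + real (card F))"
      using insert.IH[OF F] by simp
    also have "\<dots> \<le> 3 * variance\<^sup>2 * (real (card F) + 1)\<^sup>2 + (real (card F) + 1)"
      by (simp add: power2_eq_square algebra_simps)
    finally show ?case using insert.hyps by (simp add: algebra_simps)
  qed
qed

text \<open>Splitting \<open>e\<close> off from the sum over \<open>F\<close> leaves a fourth power,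
  a cross term of mean 0 and a product of independent squares.\<close>

lemma expect_centered2_csum2_le:
  assumes F: "F \<subseteq> I" and e: "e \<in> F"
  shows "expect (\<lambda>x. (centered e x)\<^sup>2 * (csum F x)\<^sup>2) \<le> variance\<^sup>2 * real (card F) + 1"
proof -
  let ?G = "F - {e}"
  have G: "?G \<subseteq> I" and e': "e \<in> I" using F e by auto
  have "expect (\<lambda>x. (centered e x)\<^sup>2 * (csum F x)\<^sup>2) =
        expect (\<lambda>x. centered e x ^ 4 + centered e x ^ 3 * (2 * csum ?G x) +
          (centered e x)\<^sup>2 * (csum ?G x)\<^sup>2)"
    unfolding csum_remove[OF F e]
    by (simp add: power2_eq_square power3_eq_cube power4_eq_xxxx algebra_simps)
  also have "\<dots> = expect (\<lambda>x. centered e x ^ 4) + expect (\<lambda>x. centered e x ^ 3 * (2 * csum ?G x)) +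
          expect (\<lambda>x. (centered e x)\<^sup>2 * (csum ?G x)\<^sup>2)"
    by (simp only: Bochner_Integration.integral_add integrable_product_law)
  also have "expect (\<lambda>x. centered e x ^ 3 * (2 * csum ?G x)) = 0"
    using e' by (intro expect_centered3_mult) (auto simp: expect_csum[OF G])
  also have "expect (\<lambda>x. (centered e x)\<^sup>2 * (csum ?G x)\<^sup>2) = variance * (variance * real (card ?G))"
    using e' by (subst expect_centered2_mult) (auto simp: expect_csum_power2[OF G])
  also have "expect (\<lambda>x. centered e x ^ 4) \<le> expect (\<lambda>_. 1)"
    by (intro expect_mono centered_power4_le_1)
  also have "variance * (variance * real (card ?G)) \<le> variance\<^sup>2 * real (card F)"
    unfolding power2_eq_square mult.assoc
    using variance_nonneg finite_subset[OF F finite_I]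
    by (intro mult_left_mono) (auto intro: card_mono)
  finally show ?thesis by simp
qed

lemma expect_centered2_centered2_le:
  assumes "e \<in> I" "e' \<in> I"
  shows "expect (\<lambda>x. (centered e x)\<^sup>2 * (centered e' x)\<^sup>2) \<le> variance\<^sup>2 + of_bool (e = e')"
proof (cases "e = e'")
  case True
  have "expect (\<lambda>x. (centered e x)\<^sup>2 * (centered e' x)\<^sup>2) \<le> expect (\<lambda>_. 1)"
    using centered_power4_le_1 by (intro expect_mono) (simp add: True flip: power_add)
  then show ?thesis using True by (simp add: add_increasing)
next
  case False
  have "expect (\<lambda>x. (centered e x)\<^sup>2 * (centered e' x)\<^sup>2) = variance * expect (\<lambda>x. (centered e' x)\<^sup>2 * 1)"
    using assms False by (subst expect_centered2_mult) auto
  also have "\<dots> = variance * variance"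
    using assms by (subst expect_centered2_mult) auto
  finally show ?thesis using False by (simp add: power2_eq_square)
qed

text \<open>The inner expression is a diagonal entry of the squared centered Laplacian, with
  \<open>F\<close> the edges at the vertex. The constant 6 is 3 from the fourth moment of the sum, 2
  from the mixed term and 1 from the square of the sum of squares.\<close>

lemma expect_star_square_le:
  assumes F: "F \<subseteq> I"
  shows "expect (\<lambda>x. ((csum F x)\<^sup>2 + (\<Sum>e\<in>F. (centered e x)\<^sup>2))\<^sup>2) \<le>
           6 * variance\<^sup>2 * (real (card F))\<^sup>2 + 4 * real (card F)"
proof -
  have fin: "finite F" using F finite_I by (rule finite_subset)
  have "expect (\<lambda>x. ((csum F x)\<^sup>2 + (\<Sum>e\<in>F. (centered e x)\<^sup>2))\<^sup>2) =
     expect (\<lambda>x. csum F x ^ 4 + 2 * (\<Sum>e\<in>F. (centered e x)\<^sup>2 * (csum F x)\<^sup>2) +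
       (\<Sum>e\<in>F. \<Sum>e'\<in>F. (centered e x)\<^sup>2 * (centered e' x)\<^sup>2))"
  proof (rule arg_cong[where f = expect], rule ext)
    fix x
    have "((csum F x)\<^sup>2 + (\<Sum>e\<in>F. (centered e x)\<^sup>2))\<^sup>2 =
      csum F x ^ 4 + 2 * ((\<Sum>e\<in>F. (centered e x)\<^sup>2) * (csum F x)\<^sup>2) +
      (\<Sum>e\<in>F. (centered e x)\<^sup>2) * (\<Sum>e\<in>F. (centered e x)\<^sup>2)"
      by (simp only: power2_eq_square power4_eq_xxxx) (simp add: algebra_simps)
    then show "((csum F x)\<^sup>2 + (\<Sum>e\<in>F. (centered e x)\<^sup>2))\<^sup>2 =
      csum F x ^ 4 + 2 * (\<Sum>e\<in>F. (centered e x)\<^sup>2 * (csum F x)\<^sup>2) +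
       (\<Sum>e\<in>F. \<Sum>e'\<in>F. (centered e x)\<^sup>2 * (centered e' x)\<^sup>2)"
      by (simp only: sum_product) (simp only: sum_distrib_right)
  qed
  also have "\<dots> = expect (\<lambda>x. csum F x ^ 4) + 2 * (\<Sum>e\<in>F. expect (\<lambda>x. (centered e x)\<^sup>2 * (csum F x)\<^sup>2)) +
       (\<Sum>e\<in>F. \<Sum>e'\<in>F. expect (\<lambda>x. (centered e x)\<^sup>2 * (centered e' x)\<^sup>2))"
    by (simp add: Bochner_Integration.integral_add Bochner_Integration.integral_sum)
  also have "\<dots> \<le> (3 * variance\<^sup>2 * (real (card F))\<^sup>2 + real (card F)) +
       2 * (\<Sum>e\<in>F. variance\<^sup>2 * real (card F) + 1) + (\<Sum>e\<in>F. \<Sum>e'\<in>F. variance\<^sup>2 + of_bool (e = e'))"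
    using F by (intro add_mono mult_left_mono sum_mono expect_csum_power4_le expect_centered2_csum2_le
        expect_centered2_centered2_le) auto
  also have "\<dots> = 6 * variance\<^sup>2 * (real (card F))\<^sup>2 + 4 * real (card F)"
    using fin by (simp add: sum.distrib of_bool_def algebra_simps power2_eq_square)
  finally show ?thesis .
qed

end

section \<open>The centered Laplacian of a random graph\<close>

text \<open>The pair of vertices belonging to two matrix indices. On the diagonal it degenerates to
  a singleton, which lies outside \<open>vertex_pairs n\<close>.\<close>

definition edge :: "nat \<Rightarrow> nat \<Rightarrow> nat set" where
  "edge i j = {Suc i, Suc j}"

lemma edge_commute: "edge i j = edge j i"
  by (simp add: edge_def insert_commute)

lemma edge_eq_iff: "edge i j = edge k l \<longleftrightarrow> i = k \<and> j = l \<or> i = l \<and> j = k"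
  by (auto simp: edge_def doubleton_eq_iff)

lemma edge_in_vertex_pairs: "i < n \<Longrightarrow> j < n \<Longrightarrow> i \<noteq> j \<Longrightarrow> edge i j \<in> vertex_pairs n"
  by (auto simp: edge_def vertex_pairs_def)

lemma vertex_pairs_edgeE:
  assumes "e \<in> vertex_pairs n"
  obtains a b where "a < n" "b < n" "a \<noteq> b" "e = edge a b"
proof -
  from assms have e: "e \<subseteq> {1..n}" "card e = 2" by (auto simp: vertex_pairs_def)
  then obtain u v where uv: "e = {u, v}" "u \<noteq> v" by (auto simp: card_2_iff)
  with e have "u \<in> {1..n}" "v \<in> {1..n}" by auto
  with uv show ?thesis by (intro that[of "u - 1" "v - 1"]) (auto simp: edge_def)
qed

lemma card_vertex_pairs_le: "card (vertex_pairs n) \<le> n\<^sup>2"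
proof -
  have "card (vertex_pairs n) = n choose 2"
    unfolding vertex_pairs_def by (subst n_subsets) auto
  also have "\<dots> \<le> n\<^sup>2" by (simp add: choose_two power2_eq_square mult_le_mono div_le_dividend le_trans[OF div_le_dividend])
  finally show ?thesis .
qed

locale random_graph =
  fixes n :: nat and p :: real
  assumes p01: "0 < p" "p < 1"
begin

sublocale bernoulli_family "vertex_pairs n" p
  using p01 finite_vertex_pairs by unfold_locales auto

text \<open>The diagonal is set to 0 explicitly, since \<open>centered\<close> at the singleton
  \<open>edge i i\<close> need not vanish.\<close>

definition entry :: "(nat set \<Rightarrow> bool) \<Rightarrow> nat \<Rightarrow> nat \<Rightarrow> real" where
  "entry x i j = (if i = j then 0 else centered (edge i j) x)"

definition cdegree :: "(nat set \<Rightarrow> bool) \<Rightarrow> nat \<Rightarrow> real" where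
  "cdegree x i = (\<Sum>j<n. entry x i j)"

text \<open>The matrix \<open>B\<close> of the introduction.\<close>

definition centered_lap :: "(nat set \<Rightarrow> bool) \<Rightarrow> real mat" where
  "centered_lap x = Matrix.mat n n (\<lambda>(i, j). of_bool (i = j) * cdegree x i - entry x i j)"

lemma entry_commute: "entry x i j = entry x j i"
  by (simp add: entry_def edge_commute)

lemma entry_diag [simp]: "entry x i i = 0"
  by (simp add: entry_def)

lemma centered_lap_carrier: "centered_lap x \<in> carrier_mat n n"
  by (simp add: centered_lap_def)

lemma centered_lap_index: "i < n \<Longrightarrow> j < n \<Longrightarrow> centered_lap x $$ (i, j) = of_bool (i = j) * cdegree x i - entry x i j"
  by (simp add: centered_lap_def)

lemma centered_lap_symmetric: "transpose_mat (centered_lap x) = centered_lap x"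
  by (rule eq_matI) (auto simp: centered_lap_def entry_commute)

definition star :: "nat \<Rightarrow> nat set set" where
  "star i = edge i ` ({..<n} - {i})"

lemma inj_edge: "inj_on (edge i) A"
  by (auto simp: inj_on_def edge_eq_iff)

lemma star_subset: "i < n \<Longrightarrow> star i \<subseteq> vertex_pairs n"
  by (auto simp: star_def intro: edge_in_vertex_pairs)

lemma card_star: "i < n \<Longrightarrow> card (star i) = n - 1"
  by (simp add: star_def card_image inj_edge)

lemma edge_notin_star: "i \<noteq> k \<Longrightarrow> i \<noteq> j \<Longrightarrow> edge k j \<notin> star i"
  by (auto simp: star_def edge_eq_iff)

text \<open>Turns a row sum into a sum over distinct edges, to which the moment bounds for
  \<open>csum\<close> apply. The condition \<open>h 0 = 0\<close> removes the diagonal entry; the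
  relevant cases are the identity and the square.\<close>

lemma sum_entry_eq:
  assumes "i < n" and "h 0 = 0"
  shows "(\<Sum>j<n. h (entry x i j)) = (\<Sum>e\<in>star i. h (centered e x) :: real)"
proof -
  have "(\<Sum>j<n. h (entry x i j)) = (\<Sum>j\<in>{..<n} - {i}. h (entry x i j))"
    using assms by (intro sum.mono_neutral_right) auto
  also have "\<dots> = (\<Sum>j\<in>{..<n} - {i}. h (centered (edge i j) x))"
    by (intro sum.cong) (auto simp: entry_def)
  finally show ?thesis by (simp add: star_def sum.reindex inj_edge)
qed

lemma cdegree_eq: "i < n \<Longrightarrow> cdegree x i = csum (star i) x"
  using sum_entry_eq[of i "\<lambda>y. y" x] by (simp add: cdegree_def csum_def)

section \<open>Expected traces of the second and fourth powers\<close>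

lemma expect_entry_power2:
  assumes "i < n" "j < n"
  shows "expect (\<lambda>x. (entry x i j)\<^sup>2) = (if i = j then 0 else variance)"
  using expect_centered2_mult[of "edge i j" "\<lambda>_. 1"] edge_in_vertex_pairs[OF assms]
  by (auto simp: entry_def)

text \<open>With v = \<open>variance\<close>, the diagonal holds \<open>n\<close> degrees of
  variance (n - 1) v each, and the n (n - 1) entries off the diagonal have variance v each.\<close>

lemma expect_sum_square:
  "expect (\<lambda>x. \<Sum>k<n. \<Sum>l<n. (centered_lap x $$ (k, l))\<^sup>2) = 2 * real n * (real n - 1) * variance"
proof -
  have sq: "(centered_lap x $$ (k, l))\<^sup>2 = of_bool (k = l) * (csum (star k) x)\<^sup>2 + (entry x k l)\<^sup>2"
    if "k < n" "l < n" for x k l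
    using that by (auto simp: centered_lap_index cdegree_eq)
  have "expect (\<lambda>x. \<Sum>k<n. \<Sum>l<n. (centered_lap x $$ (k, l))\<^sup>2) =
        (\<Sum>k<n. \<Sum>l<n. expect (\<lambda>x. (centered_lap x $$ (k, l))\<^sup>2))"
    by (simp add: Bochner_Integration.integral_sum)
  also have "\<dots> = (\<Sum>k<n. \<Sum>l<n. of_bool (k = l) * (variance * (real n - 1)) + (if k = l then 0 else variance))"
  proof (intro sum.cong refl)
    fix k l assume kl: "k \<in> {..<n}" "l \<in> {..<n}"
    then have "expect (\<lambda>x. (centered_lap x $$ (k, l))\<^sup>2) =
          of_bool (k = l) * expect (\<lambda>x. (csum (star k) x)\<^sup>2) + expect (\<lambda>x. (entry x k l)\<^sup>2)"
      by (simp add: sq Bochner_Integration.integral_add)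
    also have "\<dots> = of_bool (k = l) * (variance * (real n - 1)) + (if k = l then 0 else variance)"
      using kl by (simp add: expect_csum_power2[OF star_subset] card_star expect_entry_power2 of_nat_diff)
    finally show "expect (\<lambda>x. (centered_lap x $$ (k, l))\<^sup>2) =
       of_bool (k = l) * (variance * (real n - 1)) + (if k = l then 0 else variance)" .
  qed
  also have "\<dots> = (\<Sum>k<n. \<Sum>l<n. of_bool (k = l) * (variance * (real n - 2)) + variance)"
    by (intro sum.cong refl) (auto simp: algebra_simps)
  also have "\<dots> = real n * (variance * (real n - 2)) + real n * (real n * variance)"
    by (simp add: sum.distrib of_bool_def if_distrib[of "\<lambda>x. x * _"] distrib_left cong: if_cong)
  also have "\<dots> = 2 * real n * (real n - 1) * variance" by (simp add: algebra_simps)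
  finally show ?thesis .
qed

text \<open>Entrywise form of (D - Y)^2 = D^2 - (D Y + Y D) + Y^2 with D the diagonal of centered
  degrees and Y the matrix of entries.\<close>

lemma centered_lap_square:
  assumes "i < n" "j < n"
  shows "(\<Sum>r<n. centered_lap x $$ (i, r) * centered_lap x $$ (r, j)) =
    of_bool (i = j) * (cdegree x i)\<^sup>2 - (cdegree x i + cdegree x j) * entry x i j
      + (\<Sum>r<n. entry x i r * entry x r j)"
proof -
  have "(\<Sum>r<n. centered_lap x $$ (i, r) * centered_lap x $$ (r, j)) =
     (\<Sum>r<n. of_bool (i = r) * (of_bool (r = j) * cdegree x i * cdegree x j) - of_bool (i = r) * (cdegree x i * entry x r j)
        - of_bool (r = j) * (entry x i r * cdegree x j) + entry x i r * entry x r j)"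
    using assms by (intro sum.cong) (auto simp: centered_lap_index algebra_simps)
  also have "\<dots> = of_bool (i = j) * cdegree x i * cdegree x j - cdegree x i * entry x i j
        - entry x i j * cdegree x j + (\<Sum>r<n. entry x i r * entry x r j)"
    using assms
    by (simp add: sum.distrib sum_subtractf of_bool_def if_distrib[of "\<lambda>x. x * _"] cong: if_cong)
  finally show ?thesis by (auto simp: algebra_simps power2_eq_square)
qed

lemma expect_square_diag_le:
  assumes i: "i < n"
  shows "expect (\<lambda>x. (\<Sum>r<n. centered_lap x $$ (i, r) * centered_lap x $$ (r, i))\<^sup>2) \<le>
           6 * variance\<^sup>2 * (real n)\<^sup>2 + 4 * real n"
proof -
  have "(\<Sum>r<n. centered_lap x $$ (i, r) * centered_lap x $$ (r, i)) =
        (csum (star i) x)\<^sup>2 + (\<Sum>e\<in>star i. (centered e x)\<^sup>2)" for x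
    using sum_entry_eq[OF i, of "\<lambda>y. y\<^sup>2" x]
    by (simp add: centered_lap_square[OF i i] cdegree_eq[OF i] entry_commute[of x _ i] power2_eq_square)
  then have "expect (\<lambda>x. (\<Sum>r<n. centered_lap x $$ (i, r) * centered_lap x $$ (r, i))\<^sup>2) \<le>
      6 * variance\<^sup>2 * (real (card (star i)))\<^sup>2 + 4 * real (card (star i))"
    using expect_star_square_le[OF star_subset[OF i]] by simp
  also have "\<dots> \<le> 6 * variance\<^sup>2 * (real n)\<^sup>2 + 4 * real n"
    using i by (intro add_mono mult_left_mono power_mono) (auto simp: card_star)
  finally show ?thesis .
qed

text \<open>The entry is T - (d_i + d_j) y_e, where \<open>e\<close> joins the two vertices and
  \<open>T\<close> sums over two-step paths through the other vertices in \<open>K\<close>. With v =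
  \<open>variance\<close>, the square of \<open>T\<close> contributes at most v^2 n, the mixed term
  has mean 0, and the square of the degree term contributes at most 2 v^2 n + 4.\<close>

lemma expect_square_offdiag_le:
  assumes i: "i < n" and j: "j < n" and ij: "i \<noteq> j"
  shows "expect (\<lambda>x. (\<Sum>r<n. centered_lap x $$ (i, r) * centered_lap x $$ (r, j))\<^sup>2) \<le> 3 * variance\<^sup>2 * real n + 4"
proof -
  define K where "K = {..<n} - {i, j}"
  define e where "e = edge i j"
  define G where "G = edge i ` K \<union> edge j ` K"
  define T where "T x = (\<Sum>k\<in>K. centered (edge i k) x * centered (edge k j) x)" for x
  have e: "e \<in> vertex_pairs n" unfolding e_def by (rule edge_in_vertex_pairs[OF i j ij])
  have K: "finite K" "\<And>k. k \<in> K \<Longrightarrow> k < n \<and> k \<noteq> i \<and> k \<noteq> j" by (auto simp: K_def)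
  have cardK: "card K \<le> n" unfolding K_def by (metis card_Diff_subset_Int card_lessThan diff_le_self finite_Int finite.emptyI finite_insert)
  have G: "G \<subseteq> vertex_pairs n" using K i j by (auto simp: G_def intro!: edge_in_vertex_pairs)
  have eG: "e \<notin> G" using K(2)[of i] K(2)[of j] ij by (auto simp: G_def e_def edge_eq_iff)
  have cardG: "card G \<le> 2 * n"
  proof -
    have "card G \<le> card (edge i ` K) + card (edge j ` K)" unfolding G_def by (rule card_Un_le)
    also have "\<dots> \<le> n + n" using cardK by (intro add_mono order_trans[OF card_image_le]) (auto simp: K)
    finally show ?thesis by simp
  qed
  have star_i: "star i = insert e (edge i ` K)" using i j ij by (auto simp: star_def e_def K_def)
  have star_j: "star j = insert e (edge j ` K)" using i j ij
    by (auto simp: star_def e_def K_def edge_commute[of i j])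
  \<comment> \<open>The edge \<open>e\<close> lies in both stars and counts twice; the remaining
    edges at the two vertices are distinct and form \<open>G\<close>.\<close>
  have deg: "cdegree x i + cdegree x j = 2 * centered e x + csum G x" for x
  proof -
    have "edge i ` K \<inter> edge j ` K = {}" using K ij by (auto simp: edge_eq_iff)
    then have "csum G x = csum (edge i ` K) x + csum (edge j ` K) x"
      unfolding csum_def G_def using K by (intro sum.union_disjoint) auto
    moreover have "csum (star i) x = centered e x + csum (edge i ` K) x"
      unfolding csum_def star_i using K eG by (intro sum.insert) (auto simp: G_def)
    moreover have "csum (star j) x = centered e x + csum (edge j ` K) x"
      unfolding csum_def star_j using K eG by (intro sum.insert) (auto simp: G_def)
    ultimately show ?thesis by (simp add: cdegree_eq i j)
  qed
  have entry_ij: "entry x i j = centered e x" for x using ij by (simp add: entry_def e_def)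
  have T: "(\<Sum>r<n. entry x i r * entry x r j) = T x" for x
  proof -
    have "(\<Sum>r<n. entry x i r * entry x r j) = (\<Sum>r\<in>K. entry x i r * entry x r j)"
      unfolding K_def by (intro sum.mono_neutral_right) auto
    also have "\<dots> = T x" unfolding T_def by (intro sum.cong) (auto simp: entry_def K_def)
    finally show ?thesis .
  qed
  have "expect (\<lambda>x. (\<Sum>r<n. centered_lap x $$ (i, r) * centered_lap x $$ (r, j))\<^sup>2) =
    expect (\<lambda>x. (T x - (cdegree x i + cdegree x j) * centered e x)\<^sup>2)"
    using ij by (simp add: centered_lap_square[OF i j] T entry_ij)
  also have "\<dots> = expect (\<lambda>x. (T x)\<^sup>2 - 2 * ((cdegree x i + cdegree x j) * centered e x * T x) +
      (2 * centered e x + csum G x)\<^sup>2 * (centered e x)\<^sup>2)"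
    unfolding deg by (simp add: power2_eq_square algebra_simps)
  also have "\<dots> = expect (\<lambda>x. (T x)\<^sup>2) - 2 * expect (\<lambda>x. (cdegree x i + cdegree x j) * centered e x * T x) +
      expect (\<lambda>x. (2 * centered e x + csum G x)\<^sup>2 * (centered e x)\<^sup>2)"
    by (simp add: Bochner_Integration.integral_add Bochner_Integration.integral_diff)
  also have "expect (\<lambda>x. (T x)\<^sup>2) = (\<Sum>k\<in>K. \<Sum>l\<in>K. of_bool (k = l) * variance\<^sup>2)"
  proof -
    have "expect (\<lambda>x. (T x)\<^sup>2) = (\<Sum>k\<in>K. \<Sum>l\<in>K. expect (\<lambda>x. centered (edge i k) x * (centered (edge k j) x *
        (centered (edge i l) x * centered (edge l j) x))))"
      unfolding T_def power2_eq_square sum_product by (simp add: Bochner_Integration.integral_sum mult_ac)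
    also have "\<dots> = (\<Sum>k\<in>K. \<Sum>l\<in>K. of_bool (k = l) * variance\<^sup>2)"
    proof (intro sum.cong refl)
      fix k l assume kl: "k \<in> K" "l \<in> K"
      note k = K(2)[OF kl(1)] and l = K(2)[OF kl(2)]
      show "expect (\<lambda>x. centered (edge i k) x * (centered (edge k j) x *
        (centered (edge i l) x * centered (edge l j) x))) = of_bool (k = l) * variance\<^sup>2"
      proof (cases "k = l")
        case True
        have "expect (\<lambda>x. centered (edge i k) x * (centered (edge k j) x *
          (centered (edge i l) x * centered (edge l j) x))) =
          expect (\<lambda>x. (centered (edge i k) x)\<^sup>2 * ((centered (edge k j) x)\<^sup>2 * 1))"
          by (simp add: True power2_eq_square mult_ac)
        also have "\<dots> = variance * expect (\<lambda>x. (centered (edge k j) x)\<^sup>2 * 1)"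
          using k i ij by (intro expect_centered2_mult edge_in_vertex_pairs) (auto simp: edge_eq_iff)
        also have "expect (\<lambda>x. (centered (edge k j) x)\<^sup>2 * 1) = variance * expect (\<lambda>_. 1)"
          using k j by (intro expect_centered2_mult edge_in_vertex_pairs) auto
        finally show ?thesis using True by (simp add: power2_eq_square)
      next
        \<comment> \<open>For different middle vertices the edge from \<open>i\<close> to
          \<open>k\<close> occurs only once in the product, so the mean is 0.\<close>
        case False
        then show ?thesis using k l i ij
          by (subst expect_centered_mult) (auto simp: edge_eq_iff intro!: edge_in_vertex_pairs)
      qed
    qed
    finally show ?thesis .
  qed
  also have "\<dots> = real (card K) * variance\<^sup>2" using K(1) by (simp add: of_bool_def if_distrib[of "\<lambda>x. x * _"] cong: if_cong)
  \<comment> \<open>Splitting the sum of the degrees, each product has an edge that occurs only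
    once: the edge from \<open>k\<close> to \<open>j\<close> avoids the star of \<open>i\<close>,
    and the edge from \<open>i\<close> to \<open>k\<close> avoids the star of
    \<open>j\<close>.\<close>
  also have "expect (\<lambda>x. (cdegree x i + cdegree x j) * centered e x * T x) = 0"
  proof -
    have "expect (\<lambda>x. (cdegree x i + cdegree x j) * centered e x * T x) =
      expect (\<lambda>x. \<Sum>k\<in>K. centered (edge k j) x * (csum (star i) x * centered e x * centered (edge i k) x) +
         centered (edge i k) x * (csum (star j) x * centered e x * centered (edge k j) x))"
      unfolding T_def sum_distrib_left by (simp add: cdegree_eq i j algebra_simps)
    also have "\<dots> = (\<Sum>k\<in>K. expect (\<lambda>x. centered (edge k j) x * (csum (star i) x * centered e x * centered (edge i k) x)) +
         expect (\<lambda>x. centered (edge i k) x * (csum (star j) x * centered e x * centered (edge k j) x)))"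
      by (simp only: Bochner_Integration.integral_sum Bochner_Integration.integral_add integrable_product_law)
    also have "\<dots> = (\<Sum>k\<in>K. 0 + 0)"
    proof (intro sum.cong refl arg_cong2[where f = "(+)"])
      fix k assume "k \<in> K"
      note k = K(2)[OF this]
      have n1: "edge k j \<notin> star i" "e \<noteq> edge k j" "edge i k \<noteq> edge k j"
        using k ij by (auto simp: edge_notin_star e_def edge_eq_iff)
      then show "expect (\<lambda>x. centered (edge k j) x * (csum (star i) x * centered e x * centered (edge i k) x)) = 0"
        using k j by (intro expect_centered_mult edge_in_vertex_pairs) auto
      have n2: "edge i k \<notin> star j" "e \<noteq> edge i k" "edge k j \<noteq> edge i k"
        using k ij by (auto simp: edge_notin_star e_def edge_eq_iff)
      then show "expect (\<lambda>x. centered (edge i k) x * (csum (star j) x * centered e x * centered (edge k j) x)) = 0"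
        using k i by (intro expect_centered_mult edge_in_vertex_pairs) auto
    qed
    finally show ?thesis by simp
  qed
  also have "expect (\<lambda>x. (2 * centered e x + csum G x)\<^sup>2 * (centered e x)\<^sup>2) =
      expect (\<lambda>x. 4 * centered e x ^ 4 + centered e x ^ 3 * (4 * csum G x) + (centered e x)\<^sup>2 * (csum G x)\<^sup>2)"
    by (simp add: power2_eq_square power3_eq_cube power4_eq_xxxx algebra_simps)
  also have "\<dots> = 4 * expect (\<lambda>x. centered e x ^ 4) + expect (\<lambda>x. centered e x ^ 3 * (4 * csum G x)) +
      expect (\<lambda>x. (centered e x)\<^sup>2 * (csum G x)\<^sup>2)"
    by (simp add: Bochner_Integration.integral_add)
  also have "expect (\<lambda>x. centered e x ^ 3 * (4 * csum G x)) = 0"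
    using e eG by (intro expect_centered3_mult) (auto simp: expect_csum[OF G])
  also have "expect (\<lambda>x. (centered e x)\<^sup>2 * (csum G x)\<^sup>2) = variance * (variance * real (card G))"
    using e eG by (subst expect_centered2_mult) (auto simp: expect_csum_power2[OF G])
  also have "4 * expect (\<lambda>x. centered e x ^ 4) \<le> 4 * expect (\<lambda>_. 1)"
    by (intro mult_left_mono expect_mono centered_power4_le_1) auto
  finally have "expect (\<lambda>x. (\<Sum>r<n. centered_lap x $$ (i, r) * centered_lap x $$ (r, j))\<^sup>2) \<le>
     variance\<^sup>2 * real (card K) + 4 + variance\<^sup>2 * real (card G)"
    by (simp add: power2_eq_square algebra_simps)
  also have "\<dots> \<le> variance\<^sup>2 * real n + 4 + variance\<^sup>2 * (2 * real n)"
    using cardK cardG by (intro add_mono mult_left_mono) auto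
  finally show ?thesis by (simp add: algebra_simps)
qed

text \<open>The constant 9 is 6 from the \<open>n\<close> diagonal entries, each of order n^2, plus
  3 from the entries off the diagonal, about n^2 many and each of order \<open>n\<close>.\<close>

lemma expect_sum_quartic_le:
  "expect (\<lambda>x. \<Sum>k<n. \<Sum>l<n. (\<Sum>r<n. centered_lap x $$ (k, r) * centered_lap x $$ (r, l))\<^sup>2) \<le>
     9 * variance\<^sup>2 * real n ^ 3 + 8 * (real n)\<^sup>2"
proof -
  have "expect (\<lambda>x. \<Sum>k<n. \<Sum>l<n. (\<Sum>r<n. centered_lap x $$ (k, r) * centered_lap x $$ (r, l))\<^sup>2) =
        (\<Sum>k<n. \<Sum>l<n. expect (\<lambda>x. (\<Sum>r<n. centered_lap x $$ (k, r) * centered_lap x $$ (r, l))\<^sup>2))"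
    by (simp add: Bochner_Integration.integral_sum)
  \<comment> \<open>The off-diagonal bound is granted to the diagonal as well; this costs only lower
    order and lets the double sum split.\<close>
  also have "\<dots> \<le> (\<Sum>k<n. \<Sum>l<n. of_bool (k = l) * (6 * variance\<^sup>2 * (real n)\<^sup>2 + 4 * real n) +
        (3 * variance\<^sup>2 * real n + 4))"
  proof (intro sum_mono)
    fix k l assume kl: "k \<in> {..<n}" "l \<in> {..<n}"
    have nn: "0 \<le> 3 * variance\<^sup>2 * real n + 4" by simp
    show "expect (\<lambda>x. (\<Sum>r<n. centered_lap x $$ (k, r) * centered_lap x $$ (r, l))\<^sup>2) \<le>
        of_bool (k = l) * (6 * variance\<^sup>2 * (real n)\<^sup>2 + 4 * real n) + (3 * variance\<^sup>2 * real n + 4)"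
    proof (cases "k = l")
      case True
      then show ?thesis using add_increasing2[OF nn expect_square_diag_le[of k]] kl by simp
    next
      case False
      then show ?thesis using expect_square_offdiag_le[of k l] kl by simp
    qed
  qed
  also have "\<dots> = real n * (6 * variance\<^sup>2 * (real n)\<^sup>2 + 4 * real n) + real n * (real n * (3 * variance\<^sup>2 * real n + 4))"
    by (simp add: sum.distrib of_bool_def if_distrib[of "\<lambda>x. x * _"] distrib_left cong: if_cong)
  also have "\<dots> = 9 * variance\<^sup>2 * real n ^ 3 + 8 * (real n)\<^sup>2"
    by (simp add: power2_eq_square power3_eq_cube algebra_simps)
  finally show ?thesis .
qed

section \<open>Fluctuations of the trace norm and of the degree sum\<close>

text \<open>Switching on the edge between \<open>a\<close> and \<open>b\<close> adds w w^T with w =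
  e_a - e_b, a rank-one matrix of trace norm 2. The perturbation bound is applied in both
  directions, with one rank-one term of weight 1 or -1.\<close>

lemma trace_norm_centered_lap_lipschitz:
  assumes e: "e \<in> vertex_pairs n"
  shows "\<bar>trace_norm (centered_lap (x(e := True))) - trace_norm (centered_lap (x(e := False)))\<bar> \<le> 2"
proof -
  obtain a b where ab: "a < n" "b < n" "a \<noteq> b" "e = edge a b" using vertex_pairs_edgeE[OF e] .
  define w :: "nat \<Rightarrow> real" where "w k = of_bool (k = a) - of_bool (k = b)" for k
  let ?A = "centered_lap (x(e := True))" and ?B = "centered_lap (x(e := False))"
  have ent: "entry (x(e := True)) k l = entry (x(e := False)) k l +
      (of_bool (k = a) * of_bool (l = b) + of_bool (k = b) * of_bool (l = a))" for k l
    using ab by (auto simp: entry_def centered_def edge_eq_iff)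
  have deg: "cdegree (x(e := True)) k = cdegree (x(e := False)) k + (of_bool (k = a) + of_bool (k = b))" for k
    unfolding cdegree_def ent using ab
    by (simp add: sum.distrib of_bool_def if_distrib[of "\<lambda>x. _ * x"] cong: if_cong)
  have AB: "?A $$ (k, l) = ?B $$ (k, l) + w k * w l" if "k < n" "l < n" for k l
    unfolding centered_lap_index[OF that] deg ent using ab by (auto simp: w_def)
  have nw: "(\<Sum>k<n. (w k)\<^sup>2) = 2"
  proof -
    have "(\<Sum>k<n. (w k)\<^sup>2) = (\<Sum>k<n. of_bool (k = a) + of_bool (k = b))"
      using ab by (intro sum.cong) (auto simp: w_def)
    then show ?thesis using ab by (simp add: sum.distrib of_bool_def)
  qed
  have "trace_norm ?A \<le> trace_norm ?B + (\<Sum>r\<in>{()}. \<bar>1\<bar> * (\<Sum>k<n. (w k)\<^sup>2))"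
    by (rule trace_norm_perturbation_le[OF centered_lap_carrier centered_lap_symmetric centered_lap_carrier centered_lap_symmetric])
      (auto simp: AB)
  moreover have "trace_norm ?B \<le> trace_norm ?A + (\<Sum>r\<in>{()}. \<bar>-1\<bar> * (\<Sum>k<n. (w k)\<^sup>2))"
    by (rule trace_norm_perturbation_le[OF centered_lap_carrier centered_lap_symmetric centered_lap_carrier centered_lap_symmetric])
      (auto simp: AB)
  ultimately show ?thesis by (simp add: nw)
qed

lemma trace_norm_centered_lap_variance_le:
  "expect (\<lambda>x. (trace_norm (centered_lap x) - expect (\<lambda>x. trace_norm (centered_lap x)))\<^sup>2) \<le> 4 * (real n)\<^sup>2"
proof -
  have "expect (\<lambda>x. (trace_norm (centered_lap x) - expect (\<lambda>x. trace_norm (centered_lap x)))\<^sup>2) \<le>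
      real (card (vertex_pairs n)) * 2\<^sup>2"
    unfolding product_law_def
    by (rule variance_lipschitz_Pi_bernoulli[OF finite_I p_bounds trace_norm_centered_lap_lipschitz])
  also have "\<dots> \<le> 4 * (real n)\<^sup>2"
    using card_vertex_pairs_le[of n] by (simp flip: of_nat_power)
  finally show ?thesis .
qed

text \<open>Controls the deviation of the average degree in the comparison of the two Laplacians.
  The degree sum counts each edge twice; listing index pairs with j < i counts each edge once, so
  the sum is twice a sum of independent centered bits.\<close>

lemma expect_degree_sum_power2_le:
  "expect (\<lambda>x. (\<Sum>i<n. cdegree x i)\<^sup>2) \<le> 4 * (real n)\<^sup>2"
proof -
  define L where "L = Sigma {..<n} (\<lambda>i. {..<i})"
  define F where "F = (\<lambda>(i, j). edge i j) ` L"
  have L: "finite L" by (simp add: L_def)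
  have inj: "inj_on (\<lambda>(i, j). edge i j) L" by (auto simp: inj_on_def L_def edge_eq_iff)
  have F: "F \<subseteq> vertex_pairs n" by (auto simp: F_def L_def intro!: edge_in_vertex_pairs)
  have "(\<Sum>i<n. cdegree x i) = 2 * csum F x" for x
  proof -
    have split: "cdegree x i = (\<Sum>j<n. of_bool (j < i) * entry x i j) + (\<Sum>j<n. of_bool (i < j) * entry x i j)" for i
      unfolding cdegree_def sum.distrib[symmetric] by (intro sum.cong refl) (auto simp: entry_def)
    have "(\<Sum>i<n. \<Sum>j<n. of_bool (i < j) * entry x i j) = (\<Sum>i<n. \<Sum>j<n. of_bool (j < i) * entry x i j)"
      by (subst sum.swap) (simp add: entry_commute)
    then have "(\<Sum>i<n. cdegree x i) = 2 * (\<Sum>i<n. \<Sum>j<n. of_bool (j < i) * entry x i j)"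
      by (simp add: split sum.distrib)
    also have "(\<Sum>i<n. \<Sum>j<n. of_bool (j < i) * entry x i j) = (\<Sum>i<n. \<Sum>j<i. entry x i j)"
    proof (rule sum.cong[OF refl])
      fix i assume "i \<in> {..<n}"
      then show "(\<Sum>j<n. of_bool (j < i) * entry x i j) = (\<Sum>j<i. entry x i j)"
        by (intro sum.mono_neutral_cong_right) auto
    qed
    also have "\<dots> = (\<Sum>(i, j)\<in>L. entry x i j)"
      unfolding L_def by (intro sum.Sigma) auto
    also have "\<dots> = (\<Sum>(i, j)\<in>L. centered (edge i j) x)"
      by (intro sum.cong) (auto simp: L_def entry_def)
    also have "\<dots> = csum F x"
      unfolding csum_def F_def by (subst sum.reindex[OF inj]) (auto intro!: sum.cong)
    finally show ?thesis .
  qed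
  then have "expect (\<lambda>x. (\<Sum>i<n. cdegree x i)\<^sup>2) = 4 * expect (\<lambda>x. (csum F x)\<^sup>2)"
    by (simp add: power_mult_distrib)
  also have "\<dots> = 4 * (variance * real (card F))" by (simp add: expect_csum_power2[OF F])
  also have "\<dots> \<le> 4 * (1 * (real n)\<^sup>2)"
  proof (intro mult_left_mono mult_mono variance_le_1)
    have "card F \<le> card (vertex_pairs n)" by (rule card_mono[OF finite_I F])
    then have "card F \<le> n\<^sup>2" using card_vertex_pairs_le[of n] by simp
    then show "real (card F) \<le> (real n)\<^sup>2" by (simp flip: of_nat_power)
  qed auto
  finally show ?thesis by simp
qed

section \<open>Comparison of the shifted and the centered Laplacian\<close>

abbreviation graph_of :: "(nat set \<Rightarrow> bool) \<Rightarrow> nat set set" where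
  "graph_of x \<equiv> {e \<in> vertex_pairs n. x e}"

lemma of_bool_edge:
  assumes "k < n" "l < n"
  shows "(of_bool (edge k l \<in> graph_of x) :: real) = entry x k l + p * of_bool (k \<noteq> l)"
proof (cases "k = l")
  case True
  then show ?thesis by (auto simp: edge_def vertex_pairs_def)
next
  case False
  then show ?thesis using edge_in_vertex_pairs[OF assms] by (simp add: entry_def centered_def)
qed

lemma degree_of_graph:
  assumes k: "k < n"
  shows "real (degree_of n (graph_of x) (Suc k)) = cdegree x k + p * (real n - 1)"
proof -
  have "real (degree_of n (graph_of x) (Suc k)) = (\<Sum>w=1..n. of_bool ({Suc k, w} \<in> graph_of x))"
    unfolding degree_of_def by (simp add: of_bool_def sum.If_cases Int_def)
  also have "\<dots> = (\<Sum>l<n. of_bool (edge k l \<in> graph_of x))"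
    by (simp add: sum.atLeast1_atMost_eq edge_def del: mem_Collect_eq)
  also have "\<dots> = (\<Sum>l<n. entry x k l + p * of_bool (k \<noteq> l))"
    using k by (intro sum.cong refl of_bool_edge) auto
  also have "\<dots> = (\<Sum>l<n. entry x k l + (p - p * of_bool (k = l)))"
    by (intro sum.cong) auto
  also have "\<dots> = cdegree x k + (\<Sum>l<n. p - p * of_bool (k = l))"
    by (simp only: cdegree_def sum.distrib)
  also have "(\<Sum>l<n. p - p * of_bool (k = l)) = p * (real n - 1)"
    using k by (simp add: sum_subtractf of_bool_def if_distrib[of "\<lambda>x. _ * x"] algebra_simps cong: if_cong)
  finally show ?thesis .
qed

text \<open>The shifted Laplacian is the centered one plus c I - p J, where J is the all-ones matrix
  and c = p - Z / n with \<open>Z\<close> the sum of the centered degrees. The trace norm of the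
  difference is at most n |c| + p n, hence at most 2 p n + |Z|.\<close>

lemma laplacian_energy_approx:
  assumes n: "n > 0"
  shows "\<bar>laplacian_energy n (graph_of x) - trace_norm (centered_lap x)\<bar> \<le> 2 * real n + \<bar>\<Sum>i<n. cdegree x i\<bar>"
proof -
  define Z where "Z = (\<Sum>i<n. cdegree x i)"
  define c where "c = p - Z / real n"
  \<comment> \<open>Rank-one form of c I - p J: an index below \<open>n\<close> stands for a
    coordinate vector with weight \<open>c\<close>, the index \<open>n\<close> for the all-ones
    vector with weight -p.\<close>
  define a where "a r = (if r < n then c else - p)" for r
  define w :: "nat \<Rightarrow> nat \<Rightarrow> real" where "w r k = (if r < n then of_bool (r = k) else 1)" for r k
  let ?M = "shifted_laplacian_mat n (graph_of x)"
  have avg: "1 / real n * (\<Sum>v=1..n. real (degree_of n (graph_of x) v)) = Z / real n + p * (real n - 1)"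
  proof -
    have "(\<Sum>v=1..n. real (degree_of n (graph_of x) v)) = (\<Sum>k<n. cdegree x k + p * (real n - 1))"
      unfolding One_nat_def sum.atLeast1_atMost_eq by (intro sum.cong refl degree_of_graph) auto
    also have "\<dots> = Z + real n * (p * (real n - 1))" by (simp add: Z_def sum.distrib)
    finally show ?thesis using n by (simp add: field_simps)
  qed
  have M: "?M $$ (k, l) = centered_lap x $$ (k, l) + (\<Sum>r\<in>{..<Suc n}. a r * w r k * w r l)" if kl: "k < n" "l < n" for k l
  proof -
    have "?M $$ (k, l) = of_bool (k = l) * (cdegree x k + p * (real n - 1) - (Z / real n + p * (real n - 1)))
        - of_bool (edge k l \<in> graph_of x)"
      unfolding shifted_laplacian_mat_def laplacian_mat_def avg
      using kl by (simp add: degree_mat_def adjacency_mat_def degree_of_graph edge_def del: mem_Collect_eq)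
    also have "\<dots> = centered_lap x $$ (k, l) + (of_bool (k = l) * c - p)"
      unfolding of_bool_edge[OF kl] centered_lap_index[OF kl] by (auto simp: c_def algebra_simps)
    also have "of_bool (k = l) * c - p = (\<Sum>r<n. if r = k then of_bool (k = l) * c else 0) - p"
      using kl by simp
    also have "\<dots> = (\<Sum>r\<in>{..<Suc n}. a r * w r k * w r l)"
      unfolding sum.lessThan_Suc
      by (simp add: a_def w_def)
    finally show ?thesis .
  qed
  have symM: "transpose_mat ?M = ?M"
    by (rule eq_matI) (auto simp: shifted_laplacian_mat_def laplacian_mat_def degree_mat_def
        adjacency_mat_def insert_commute)
  have size: "(\<Sum>r\<in>{..<Suc n}. \<bar>a r\<bar> * (\<Sum>k<n. (w r k)\<^sup>2)) \<le> 2 * real n + \<bar>Z\<bar>"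
  proof -
    have "(\<Sum>r\<in>{..<Suc n}. \<bar>a r\<bar> * (\<Sum>k<n. (w r k)\<^sup>2)) = (\<Sum>r<n. \<bar>c\<bar>) + p * real n"
      unfolding sum.lessThan_Suc using p01
      by (simp add: a_def w_def of_bool_def if_distrib[of "\<lambda>x. x\<^sup>2"] cong: if_cong)
    also have "\<dots> = real n * \<bar>c\<bar> + p * real n" by simp
    also have "\<dots> \<le> real n * (p + \<bar>Z\<bar> / real n) + p * real n"
    proof -
      have "\<bar>c\<bar> \<le> \<bar>p\<bar> + \<bar>Z / real n\<bar>" unfolding c_def by (rule abs_triangle_ineq4)
      also have "\<dots> = p + \<bar>Z\<bar> / real n" using p01 by (simp add: abs_divide)
      finally show ?thesis by (intro add_right_mono mult_left_mono) auto
    qed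
    also have "\<dots> = 2 * (p * real n) + \<bar>Z\<bar>" using n by (simp add: field_simps)
    also have "p * real n \<le> 1 * real n" using p01 by (intro mult_right_mono) auto
    finally show ?thesis by simp
  qed
  note carr = shifted_laplacian_mat_carrier[of n "graph_of x"]
  have "trace_norm ?M \<le> trace_norm (centered_lap x) + (\<Sum>r\<in>{..<Suc n}. \<bar>a r\<bar> * (\<Sum>k<n. (w r k)\<^sup>2))"
    by (rule trace_norm_perturbation_le[OF carr symM centered_lap_carrier centered_lap_symmetric _ M]) auto
  moreover have "trace_norm (centered_lap x) \<le> trace_norm ?M + (\<Sum>r\<in>{..<Suc n}. \<bar>- a r\<bar> * (\<Sum>k<n. (w r k)\<^sup>2))"
    by (rule trace_norm_perturbation_le[OF centered_lap_carrier centered_lap_symmetric carr symM])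
       (auto simp: M sum_negf simp del: sum.lessThan_Suc)
  moreover have "laplacian_energy n (graph_of x) = trace_norm ?M"
    by (simp add: laplacian_energy_def trace_norm_def)
  ultimately show ?thesis using size unfolding Z_def by (simp only: abs_minus_cancel)
qed

section \<open>Bounds on the mean, and the limit\<close>

lemma variance_pos: "variance > 0"
  using p01 by (simp add: variance_def)

lemma expect_trace_norm_upper:
  assumes n: "n > 0"
  shows "expect (\<lambda>x. trace_norm (centered_lap x)) \<le> sqrt 2 * sqrt variance * (real n * sqrt (real n))"
proof -
  \<comment> \<open>With tr B^2 of mean about 2 v n^2, v = \<open>variance\<close>, this
    \<open>t\<close> balances the two terms of the upper bound; each is then at most n t /
    2.\<close>
  define t where "t = sqrt 2 * sqrt variance * sqrt (real n)"
  have t: "t > 0" using n variance_pos by (simp add: t_def)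
  have t2: "t\<^sup>2 = 2 * variance * real n" using variance_pos by (simp add: t_def power_mult_distrib)
  have "expect (\<lambda>x. trace_norm (centered_lap x)) \<le>
     expect (\<lambda>x. (\<Sum>k<n. \<Sum>l<n. (centered_lap x $$ (k, l))\<^sup>2) / (2 * t) + real n * t / 2)"
    by (intro expect_mono trace_norm_bounds(1) centered_lap_carrier centered_lap_symmetric t)
  also have "\<dots> = expect (\<lambda>x. \<Sum>k<n. \<Sum>l<n. (centered_lap x $$ (k, l))\<^sup>2) / (2 * t) + real n * t / 2"
    by (subst Bochner_Integration.integral_add) (simp_all del: Bochner_Integration.integral_sum)
  also have "\<dots> = (2 * real n * (real n - 1) * variance) / (2 * t) + real n * t / 2"
    by (simp only: expect_sum_square)
  also have "\<dots> \<le> (2 * real n * real n * variance) / (2 * t) + real n * t / 2"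
    using t variance_pos by (intro add_right_mono divide_right_mono mult_right_mono mult_left_mono) auto
  also have "2 * real n * real n * variance = real n * t\<^sup>2" by (simp add: t2)
  also have "real n * t\<^sup>2 / (2 * t) + real n * t / 2 = real n * t"
    using t by (simp add: power2_eq_square field_simps)
  finally show ?thesis by (simp add: t_def mult_ac)
qed

lemma expect_trace_norm_lower:
  assumes n: "n > 0"
  shows "2 * sqrt 2 / 3 * sqrt variance * (real n * sqrt (real n)) -
     (2 / 3 + 16 / (81 * variance\<^sup>2)) * (3 / sqrt 2 * sqrt variance) * sqrt (real n) \<le>
     expect (\<lambda>x. trace_norm (centered_lap x))"
proof -
  \<comment> \<open>This \<open>t\<close> maximizes the leading part 3 v n^2 / t - 9 v^2 n^3 / (2
    t^3) of the lower bound, v = \<open>variance\<close>; the maximum is 4 n t / 9.\<close>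
  define t where "t = 3 / sqrt 2 * sqrt variance * sqrt (real n)"
  have t: "t > 0" using n variance_pos by (simp add: t_def)
  have t2: "t\<^sup>2 = 9 / 2 * variance * real n"
    using variance_pos by (simp add: t_def power_mult_distrib power_divide)
  then have nt: "real n = 2 * t\<^sup>2 / (9 * variance)" using variance_pos by (simp add: field_simps)
  let ?S = "\<lambda>x. \<Sum>k<n. \<Sum>l<n. (centered_lap x $$ (k, l))\<^sup>2"
  let ?Q = "\<lambda>x. \<Sum>k<n. \<Sum>l<n. (\<Sum>r<n. centered_lap x $$ (k, r) * centered_lap x $$ (r, l))\<^sup>2"
  \<comment> \<open>Eliminating \<open>n\<close> through \<open>nt\<close> leaves an identity in
    \<open>t\<close> and \<open>variance\<close>. The correction 2/3 comes from n - 1 in place of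
    \<open>n\<close>, the other one from the summand 8 n^2 in the fourth moment.\<close>
  have "4 / 9 * real n * t - (2 / 3 + 16 / (81 * variance\<^sup>2)) * t =
     3 / (2 * t) * (2 * real n * (real n - 1) * variance) -
     1 / (2 * t ^ 3) * (9 * variance\<^sup>2 * real n ^ 3 + 8 * (real n)\<^sup>2)"
    unfolding nt using t variance_pos
    by (simp add: power2_eq_square power3_eq_cube field_simps)
  also have "\<dots> \<le> 3 / (2 * t) * expect ?S - 1 / (2 * t ^ 3) * expect ?Q"
    unfolding expect_sum_square using t
    by (intro diff_left_mono mult_left_mono expect_sum_quartic_le) auto
  also have "\<dots> = expect (\<lambda>x. 3 / (2 * t) * ?S x - 1 / (2 * t ^ 3) * ?Q x)"
    by (subst Bochner_Integration.integral_diff)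
       (simp_all only: integrable_product_law integral_mult_right_zero)
  also have "\<dots> \<le> expect (\<lambda>x. trace_norm (centered_lap x))"
    by (intro expect_mono trace_norm_bounds(2) centered_lap_carrier centered_lap_symmetric t)
  finally have main: "4 / 9 * real n * t - (2 / 3 + 16 / (81 * variance\<^sup>2)) * t \<le>
      expect (\<lambda>x. trace_norm (centered_lap x))" .
  have "3 / sqrt 2 = 3 / 2 * sqrt 2" by (simp add: real_div_sqrt field_simps)
  then have "t = 3 / 2 * sqrt 2 * sqrt variance * sqrt (real n)" by (simp only: t_def)
  then have "4 / 9 * real n * t = 4 / 9 * real n * (3 / 2 * sqrt 2 * sqrt variance * sqrt (real n))"
    by (simp only:)
  also have "\<dots> = 2 * sqrt 2 / 3 * sqrt variance * (real n * sqrt (real n))" by simp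
  finally have "4 / 9 * real n * t = 2 * sqrt 2 / 3 * sqrt variance * (real n * sqrt (real n))" .
  with main show ?thesis unfolding t_def by (simp only: mult.assoc)
qed

text \<open>Chebyshev's inequality for both quantities at once: off the event the sum of their
  squares is at least N^2 = \<delta>^2 n^3, while each second moment is at most 4 n^2.\<close>

lemma concentration:
  assumes n: "n > 0" and \<delta>: "\<delta> > 0"
  shows "1 - 8 / (\<delta>\<^sup>2 * real n) \<le> measure_pmf.prob product_law
     {x. \<bar>trace_norm (centered_lap x) - expect (\<lambda>x. trace_norm (centered_lap x))\<bar> \<le> \<delta> * (real n * sqrt (real n)) \<and>
         \<bar>\<Sum>i<n. cdegree x i\<bar> \<le> \<delta> * (real n * sqrt (real n))}" (is "_ \<le> measure_pmf.prob _ ?A")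
proof -
  define N where "N = \<delta> * (real n * sqrt (real n))"
  have N: "N > 0" using n \<delta> by (simp add: N_def)
  have N2: "N\<^sup>2 = \<delta>\<^sup>2 * real n * (real n)\<^sup>2" by (simp add: N_def power_mult_distrib)
  define f where "f x = trace_norm (centered_lap x) - expect (\<lambda>x. trace_norm (centered_lap x))" for x
  define Z where "Z x = (\<Sum>i<n. cdegree x i)" for x
  have "indicat_real (- ?A) x \<le> ((f x)\<^sup>2 + (Z x)\<^sup>2) / N\<^sup>2" for x
  proof (cases "x \<in> ?A")
    case False
    then consider "N < \<bar>f x\<bar>" | "N < \<bar>Z x\<bar>" by (auto simp: N_def f_def Z_def)
    then have "N\<^sup>2 \<le> (f x)\<^sup>2 + (Z x)\<^sup>2"
    proof cases
      case 1
      then have "N\<^sup>2 \<le> \<bar>f x\<bar>\<^sup>2" using N by (intro power_mono) auto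
      then show ?thesis by (simp add: add_increasing2)
    next
      case 2
      then have "N\<^sup>2 \<le> \<bar>Z x\<bar>\<^sup>2" using N by (intro power_mono) auto
      then show ?thesis by (simp add: add_increasing)
    qed
    then show ?thesis using N False by (simp add: field_simps)
  qed simp
  then have "expect (indicat_real (- ?A)) \<le> expect (\<lambda>x. ((f x)\<^sup>2 + (Z x)\<^sup>2) / N\<^sup>2)"
    by (rule expect_mono)
  also have "\<dots> = (expect (\<lambda>x. (f x)\<^sup>2) + expect (\<lambda>x. (Z x)\<^sup>2)) / N\<^sup>2"
    by (simp add: Bochner_Integration.integral_add)
  also have "\<dots> \<le> (4 * (real n)\<^sup>2 + 4 * (real n)\<^sup>2) / N\<^sup>2"
    unfolding f_def Z_def
    by (intro divide_right_mono add_mono trace_norm_centered_lap_variance_le expect_degree_sum_power2_le) auto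
  also have "\<dots> = 8 / (\<delta>\<^sup>2 * real n)"
    unfolding N2 using n \<delta> by (simp add: field_simps)
  finally have "measure_pmf.prob product_law (- ?A) \<le> 8 / (\<delta>\<^sup>2 * real n)" by simp
  moreover have "measure_pmf.prob product_law (- ?A) = 1 - measure_pmf.prob product_law ?A"
    using measure_pmf.prob_compl[of ?A product_law] by (simp add: Compl_eq_Diff_UNIV)
  ultimately show ?thesis by simp
qed

text \<open>Four errors of size at most \<open>\<delta> * N\<close> add up: the fluctuation of the
  trace norm, the degree sum, the term 2 n of the comparison (by \<open>large1\<close>), and the
  lower-order part of the mean in the lower bound (by \<open>large2\<close>).\<close>

lemma laplacian_energy_prob_ge:
  assumes n: "n > 0" and \<delta>: "\<delta> > 0"
    and large1: "2 \<le> \<delta> * sqrt (real n)"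
    and large2: "(2 / 3 + 16 / (81 * variance\<^sup>2)) * (3 / sqrt 2 * sqrt variance) \<le> \<delta> * real n"
  defines "N \<equiv> real n * sqrt (real n)"
  shows "1 - 8 / (\<delta>\<^sup>2 * real n) \<le> measure_pmf.prob (erdos_renyi n p)
     {G. (2 * sqrt 2 / 3 * sqrt variance - 4 * \<delta>) * N \<le> laplacian_energy n G \<and>
         laplacian_energy n G \<le> (sqrt 2 * sqrt variance + 4 * \<delta>) * N}"
proof -
  have N: "N \<ge> 0" by (simp add: N_def)
  define m where "m = expect (\<lambda>x. trace_norm (centered_lap x))"
  have up: "m \<le> sqrt 2 * sqrt variance * N"
    unfolding m_def N_def by (rule expect_trace_norm_upper[OF n])
  have low: "2 * sqrt 2 / 3 * sqrt variance * N - \<delta> * N \<le> m"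
  proof -
    have "(2 / 3 + 16 / (81 * variance\<^sup>2)) * (3 / sqrt 2 * sqrt variance) * sqrt (real n) \<le> \<delta> * real n * sqrt (real n)"
      by (intro mult_right_mono large2) auto
    then show ?thesis using expect_trace_norm_lower[OF n] unfolding m_def N_def mult.assoc by linarith
  qed
  have lin: "2 * real n \<le> \<delta> * N"
    using mult_left_mono[OF large1, of "real n"] by (simp add: N_def mult_ac)
  have "1 - 8 / (\<delta>\<^sup>2 * real n) \<le> measure_pmf.prob product_law
     {x. \<bar>trace_norm (centered_lap x) - m\<bar> \<le> \<delta> * N \<and> \<bar>\<Sum>i<n. cdegree x i\<bar> \<le> \<delta> * N}"
    using concentration[OF n \<delta>] by (simp only: N_def m_def)
  also have "\<dots> \<le> measure_pmf.prob product_law (graph_of -` {G.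
         (2 * sqrt 2 / 3 * sqrt variance - 4 * \<delta>) * N \<le> laplacian_energy n G \<and>
         laplacian_energy n G \<le> (sqrt 2 * sqrt variance + 4 * \<delta>) * N})"
  proof (rule measure_pmf.finite_measure_mono)
    show "{x. \<bar>trace_norm (centered_lap x) - m\<bar> \<le> \<delta> * N \<and> \<bar>\<Sum>i<n. cdegree x i\<bar> \<le> \<delta> * N} \<subseteq> graph_of -` {G.
         (2 * sqrt 2 / 3 * sqrt variance - 4 * \<delta>) * N \<le> laplacian_energy n G \<and>
         laplacian_energy n G \<le> (sqrt 2 * sqrt variance + 4 * \<delta>) * N}"
    proof (intro subsetI vimageI2 CollectI)
      fix x assume "x \<in> {x. \<bar>trace_norm (centered_lap x) - m\<bar> \<le> \<delta> * N \<and> \<bar>\<Sum>i<n. cdegree x i\<bar> \<le> \<delta> * N}"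
      then have x: "\<bar>trace_norm (centered_lap x) - m\<bar> \<le> \<delta> * N" "\<bar>\<Sum>i<n. cdegree x i\<bar> \<le> \<delta> * N" by auto
      have "0 \<le> \<delta> * N" using \<delta> N by simp
      then show "(2 * sqrt 2 / 3 * sqrt variance - 4 * \<delta>) * N \<le> laplacian_energy n (graph_of x) \<and>
         laplacian_energy n (graph_of x) \<le> (sqrt 2 * sqrt variance + 4 * \<delta>) * N"
        using laplacian_energy_approx[OF n, of x] x up low lin
        unfolding left_diff_distrib distrib_right mult.assoc[of 4] by linarith
    qed
  qed simp
  also have "\<dots> = measure_pmf.prob (erdos_renyi n p) {G.
         (2 * sqrt 2 / 3 * sqrt variance - 4 * \<delta>) * N \<le> laplacian_energy n G \<and>
         laplacian_energy n G \<le> (sqrt 2 * sqrt variance + 4 * \<delta>) * N}"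
    by (simp only: erdos_renyi_def product_law_def measure_map_pmf)
  finally show ?thesis .
qed

end

theorem theorem4:
  fixes p \<sigma> :: real
  assumes p: "0 < p" "p < 1"
    and \<sigma>: "\<sigma> = sqrt (p * (1 - p))"
  shows "\<forall>\<epsilon>>0.
    (\<lambda>n. measure_pmf.prob (erdos_renyi n p)
       {G. (2 * sqrt 2 / 3 * \<sigma> - \<epsilon>) * real n powr (3 / 2) \<le> laplacian_energy n G \<and>
           laplacian_energy n G \<le> (sqrt 2 * \<sigma> + \<epsilon>) * real n powr (3 / 2)})
      \<longlonglongrightarrow> 1"
proof (intro allI impI)
  fix \<epsilon> :: real assume "\<epsilon> > 0"
  define \<delta> where "\<delta> = \<epsilon> / 4"
  have \<delta>: "\<delta> > 0" "4 * \<delta> = \<epsilon>" using \<open>\<epsilon> > 0\<close> by (auto simp: \<delta>_def)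
  let ?P = "\<lambda>n. measure_pmf.prob (erdos_renyi n p)
       {G. (2 * sqrt 2 / 3 * \<sigma> - \<epsilon>) * real n powr (3 / 2) \<le> laplacian_energy n G \<and>
           laplacian_energy n G \<le> (sqrt 2 * \<sigma> + \<epsilon>) * real n powr (3 / 2)}"
  define v where "v = p * (1 - p)"
  \<comment> \<open>The threshold constant of \<open>large2\<close>, written in terms of
    \<open>p\<close> alone because the locale is interpreted separately for each
    \<open>n\<close>.\<close>
  define K where "K = (2 / 3 + 16 / (81 * v\<^sup>2)) * (3 / sqrt 2 * sqrt v)"
  have "eventually (\<lambda>n::nat. n > 0) sequentially" by (rule eventually_gt_at_top)
  moreover have "eventually (\<lambda>n. 2 \<le> \<delta> * sqrt (real n)) sequentially" using \<delta>(1) by real_asymp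
  moreover have "eventually (\<lambda>n. K \<le> \<delta> * real n) sequentially" using \<delta>(1) by real_asymp
  ultimately have "eventually (\<lambda>n. 1 - 8 / (\<delta>\<^sup>2 * real n) \<le> ?P n) sequentially"
  proof eventually_elim
    case (elim n)
    interpret random_graph n p using p by unfold_locales
    have N: "real n powr (3 / 2) = real n * sqrt (real n)"
    proof -
      have "real n powr (1 + 1 / 2) = real n powr 1 * real n powr (1 / 2)" by (rule powr_add)
      then show ?thesis using elim(1) by (simp add: powr_half_sqrt)
    qed
    have v: "variance = v" by (simp add: variance_def v_def)
    show ?case
      using laplacian_energy_prob_ge[OF elim(1) \<delta>(1) elim(2)] elim(3)
      unfolding N \<sigma> v \<delta>(2) K_def v_def[symmetric] by blast
  qed
  then show "?P \<longlonglongrightarrow> 1"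
  proof (rule tendsto_sandwich)
    show "eventually (\<lambda>n. ?P n \<le> 1) sequentially" by simp
    show "(\<lambda>n. 1 - 8 / (\<delta>\<^sup>2 * real n)) \<longlonglongrightarrow> 1" using \<delta>(1) by real_asymp
  qed simp
qed

end
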